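(* Let $(d,\mathbf c,\boldsymbol\beta,\mathbf B,\nu,\boldsymbol\mu)$ be a set of admissible parameters with branching mechanism $\boldsymbol\varphi=(\varphi_1,\dots,\varphi_d)$. For all $\tilde{\boldsymbol\lambda}=(\tilde\lambda_1,\dots,\tilde\lambda_d)^\top\in\mathbb R_+^d$, consider the continuously differentiable function $\mathbb R_+\ni t\mapsto\tilde{\mathbf v}(t,\tilde{\boldsymbol\lambda})=(\tilde v_1(t,\tilde{\boldsymbol\lambda}),\dots,\tilde v_d(t,\tilde{\boldsymbol\lambda}))^\top\in\mathbb R_+^d$ which is the unique locally bounded solution to the system of differential equations $$\partial_1\tilde v_i(t,\tilde{\boldsymbol\lambda})=\tilde\lambda_i-\varphi_i(\tilde{\mathbf v}(t,\tilde{\boldsymbol\lambda})),\qquad\tilde v_i(0,\tilde{\boldsymbol\lambda})=0,\qquad i\in\{1,\dots,d\}.$$ (i) For all $\tilde{\boldsymbol\lambda}\in\mathbb R_+^d$, the function $t\mapsto\tilde{\mathbf v}(t,\tilde{\boldsymbol\lambda})$ is increasing, and, consequently, the limit $\tilde{\mathbf v}(\infty,\tilde{\boldsymbol\lambda})=(\tilde v_1(\infty,\tilde{\boldsymbol\lambda}),\dots,\tilde v_d(\infty,\tilde{\boldsymbol\lambda}))^\top:=\lim_{t\to\infty}\tilde{\mathbf v}(t,\tilde{\boldsymbol\lambda})\in[0,\infty]^d$ exists. (ii) Let $(\mathbf Z_t)_{t\ge0}$ be a multi-type CB process with parameters $(d,\mathbf c,\mathbf 0,\mathbf B,0,\boldsymbol\mu)$.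 If $\tilde{\boldsymbol\lambda}\in(0,\infty)^d$ and $i\in\{1,\dots,d\}$ are such that $\tilde v_i(\infty,\tilde{\boldsymbol\lambda})=\infty$, then $$\mathbb P_{\mathbf e_i^{(d)}}\Big(\exists\,j\in\{1,\dots,d\}:\int_0^\infty Z_{u,j}\,\mathrm du=\infty\Big)=\mathbb P_{\mathbf e_i^{(d)}}\Big(\int_0^\infty\mathbf Z_u\,\mathrm du\notin\mathbb R_+^d\Big)=1.$$ (iii) If, in addition, $\widetilde{\mathbf B}$ is irreducible, then, for all $\tilde{\boldsymbol\lambda}\in\mathbb R_+^d$ with $\tilde{\boldsymbol\lambda}\ne\mathbf 0$, we have $\tilde{\mathbf v}(\infty,\tilde{\boldsymbol\lambda})\in(0,\infty]^d$. (iv) If, in addition, $D_{\boldsymbol\varphi}\ne\emptyset$, then for all $\tilde{\boldsymbol\lambda}\in(0,\infty)^d$ satisfying $\tilde{\mathbf v}(\infty,\tilde{\boldsymbol\lambda})\in(0,\infty)^d$, we have $\tilde{\mathbf v}(\infty,\tilde{\boldsymbol\lambda})=\boldsymbol\phi(\tilde{\boldsymbol\lambda})$, where the diffeomorphism $\boldsymbol\phi|_{(0,\infty)^d}:(0,\infty)^d\to D_{\boldsymbol\varphi}$ is the inverse of $\boldsymbol\varphi|_{D_{\boldsymbol\varphi}}:D_{\boldsymbol\varphi}\to(0,\infty)^d$.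
   Context: Notation. $\mathbb R_+=[0,\infty)$, $\mathcal U_d=\mathbb R_+^d\setminus\{\mathbf 0\}$, $\|\cdot\|$ is the Euclidean norm, $\langle\cdot,\cdot\rangle$ the Euclidean inner product, $a\wedge b=\min\{a,b\}$, $x^+=\max\{0,x\}$, $\delta_{i,j}$ is the Kronecker delta, $\mathbf e^{(d)}_1,\dots,\mathbf e^{(d)}_d$ is the natural basis of $\mathbb R^d$; $\partial_1$ is the partial derivative in the first variable. An $\mathbb R^d$-valued function $f$ on $\mathbb R_+$ is increasing if $s\le t$ implies $f(s)\le f(t)$ coordinate-wise. Admissible parameters. $(d,\mathbf c,\boldsymbol\beta,\mathbf B,\nu,\boldsymbol\mu)$ is a set of admissible parameters if $d\in\mathbb N$ is a positive integer; $\mathbf c=(c_i)_{i=1}^d\in\mathbb R_+^d$; $\boldsymbol\beta=(\beta_i)_{i=1}^d\in\mathbb R_+^d$; $\mathbf B=(b_{i,j})_{i,j=1}^d\in\mathbb R^{d\times d}$ with $b_{i,j}\ge 0$ for $i\ne j$; $\nu$ is a Borel measure on $\mathcal U_d$ with $\int_{\mathcal U_d}(1\wedge\|\mathbf r\|)\,\nu(\mathrm d\mathbf r)<\infty$; and $\boldsymbol\mu=(\mu_1,\dots,\mu_d)$, where each $\mu_i$ is a Borel measure on $\mathcal U_d$ with $\int_{\mathcal U_d}\big[\|\mathbf z\|\wedge\|\mathbf z\|^2+\sum_{j\ne i}(1\wedge z_j)\big]\mu_i(\mathrm d\mathbf z)<\infty$. Branching mechanism. $\boldsymbol\varphi=(\varphi_1,\dots,\varphi_d):\mathbb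 R_+^d\to\mathbb R^d$, $$\varphi_i(\boldsymbol\lambda)=c_i\lambda_i^2-\langle\mathbf B\mathbf e_i^{(d)},\boldsymbol\lambda\rangle+\int_{\mathcal U_d}\big(\mathrm e^{-\langle\boldsymbol\lambda,\mathbf z\rangle}-1+\lambda_i(1\wedge z_i)\big)\mu_i(\mathrm d\mathbf z).$$ CB process. A multi-type CB process with parameters $(d,\mathbf c,\mathbf 0,\mathbf B,0,\boldsymbol\mu)$ is a conservative (time-homogeneous) Markov process with state space $\mathbb R_+^d$ whose transition semigroup $(P_t)_{t\ge0}$ is the unique one with $\int_{\mathbb R_+^d}\mathrm e^{-\langle\boldsymbol\lambda,\mathbf y\rangle}P_t(\mathbf x,\mathrm d\mathbf y)=\mathrm e^{-\langle\mathbf x,\mathbf v(t,\boldsymbol\lambda)\rangle}$, $\mathbf x,\boldsymbol\lambda\in\mathbb R_+^d$, $t\ge0$, where $t\mapsto\mathbf v(t,\boldsymbol\lambda)\in\mathbb R_+^d$ is the unique locally bounded (continuously differentiable) solution of $\partial_1 v_i(t,\boldsymbol\lambda)=-\varphi_i(\mathbf v(t,\boldsymbol\lambda))$, $v_i(0,\boldsymbol\lambda)=\lambda_i$, $i=1,\dots,d$. It is taken to have càdlàg sample paths; $Z_{u,j}$ is the $j$-th coordinate of $\mathbf Z_u$, and $\mathbb P_{\mathbf z}$ denotes $\mathbb P(\,\cdot\mid\mathbf Z_0=\mathbf z)$, i.e. the law of the process started from $\mathbf z$. Irreducibility. $\widetilde{\mathbf B}=(\tilde b_{i,j})_{i,j=1}^d$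 with $\tilde b_{i,j}:=b_{i,j}+\int_{\mathcal U_d}(z_i-\delta_{i,j})^+\mu_j(\mathrm d\mathbf z)$ (finite; off-diagonal entries nonnegative). A matrix $\mathbf A\in\mathbb R^{d\times d}$ is reducible if there exist a permutation matrix $\mathbf P$ and an integer $1\le p\le d-1$ such that $\mathbf P^\top\mathbf A\mathbf P=\begin{pmatrix}\mathbf A_1&\mathbf A_2\\ \mathbf 0&\mathbf A_3\end{pmatrix}$ with $\mathbf A_1\in\mathbb R^{p\times p}$, $\mathbf A_3\in\mathbb R^{(d-p)\times(d-p)}$; otherwise it is irreducible (so every $1\times1$ matrix is irreducible). Inverse of the branching mechanism. $D_{\boldsymbol\varphi}:=\{\boldsymbol\lambda\in\mathbb R_+^d:\varphi_j(\boldsymbol\lambda)>0,\ j=1,\dots,d\}$. By a known theorem of Chaumont and Marolleau (Theorem 2.1 of "Extinction times of multitype continuous-state branching processes", 2023), if $D_{\boldsymbol\varphi}\ne\emptyset$, there is a mapping $\boldsymbol\phi:\mathbb R_+^d\to\mathbb R_+^d$ whose restriction $\boldsymbol\phi|_{(0,\infty)^d}:(0,\infty)^d\to D_{\boldsymbol\varphi}$ is a diffeomorphism (differentiable bijection with differentiable inverse) with inverse $\boldsymbol\varphi|_{D_{\boldsymbol\varphi}}:D_{\boldsymbol\varphi}\to(0,\infty)^d$; $\boldsymbol\phi$ is called the inverse of $\boldsymbol\varphi$. *)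

theory Defs
  imports "HOL-Probability.Probability"
begin

text \<open>
  Vectors in \<open>\<real>\<^sup>d\<close> are elements of \<open>real ^ 'd\<close> with \<open>'d\<close> an arbitrary finite index type. The library's
  \<open>\<le>\<close> on this type is the coordinatewise order, so \<open>{0..}\<close> is the closed orthant \<open>\<real>\<^sub>+\<^sup>d\<close>. The library's
  \<open><\<close> is not coordinatewise strictness, so the open orthant is spelled out.
\<close>

definition pos_orthant :: "(real ^ 'd::finite) set" where
  "pos_orthant = {x. \<forall>j. 0 < x $ j}"

abbreviation orthant_borel :: "(real ^ 'd::finite) measure" where
  "orthant_borel \<equiv> restrict_space borel {0..}"

abbreviation punctured_orthant_borel :: "(real ^ 'd::finite) measure" where
  "punctured_orthant_borel \<equiv> restrict_space borel ({0..} - {0})"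

subsection \<open>Admissible parameters and the branching mechanism\<close>

definition admissible ::
  "real ^ 'd::finite \<Rightarrow> real ^ 'd \<Rightarrow> real ^ 'd ^ 'd \<Rightarrow> (real ^ 'd) measure \<Rightarrow> ('d \<Rightarrow> (real ^ 'd) measure) \<Rightarrow> bool"
where
  "admissible c \<beta> B \<nu> \<mu> \<longleftrightarrow>
     0 \<le> c \<and> 0 \<le> \<beta> \<and>
     (\<forall>i j. i \<noteq> j \<longrightarrow> 0 \<le> B $ i $ j) \<and>
     sets \<nu> = sets punctured_orthant_borel \<and>
     (\<integral>\<^sup>+ r. ennreal (min 1 (norm r)) \<partial>\<nu>) < \<infinity> \<and>
     (\<forall>i. sets (\<mu> i) = sets punctured_orthant_borel \<and>
        (\<integral>\<^sup>+ z. ennreal (min (norm z) ((norm z)\<^sup>2) + (\<Sum>j\<in>UNIV - {i}. min 1 (z $ j))) \<partial>\<mu> i) < \<infinity>)"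

definition branching_mechanism ::
  "real ^ 'd::finite \<Rightarrow> real ^ 'd ^ 'd \<Rightarrow> ('d \<Rightarrow> (real ^ 'd) measure) \<Rightarrow> real ^ 'd \<Rightarrow> real ^ 'd"
where
  "branching_mechanism c B \<mu> l =
     (\<chi> i. c $ i * (l $ i)\<^sup>2 - (B *v axis i 1) \<bullet> l
          + (\<integral> z. (exp (- (l \<bullet> z)) - 1 + l $ i * min 1 (z $ i)) \<partial>\<mu> i))"

definition branching_domain ::
  "real ^ 'd::finite \<Rightarrow> real ^ 'd ^ 'd \<Rightarrow> ('d \<Rightarrow> (real ^ 'd) measure) \<Rightarrow> (real ^ 'd) set"
where
  "branching_domain c B \<mu> = {l. 0 \<le> l \<and> (\<forall>j. 0 < branching_mechanism c B \<mu> l $ j)}"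

definition branching_inverse ::
  "real ^ 'd::finite \<Rightarrow> real ^ 'd ^ 'd \<Rightarrow> ('d \<Rightarrow> (real ^ 'd) measure) \<Rightarrow> (real ^ 'd \<Rightarrow> real ^ 'd) \<Rightarrow> bool"
where
  "branching_inverse c B \<mu> \<phi> \<longleftrightarrow>
     \<phi> ` {0..} \<subseteq> {0..} \<and>
     bij_betw \<phi> pos_orthant (branching_domain c B \<mu>) \<and>
     bij_betw (branching_mechanism c B \<mu>) (branching_domain c B \<mu>) pos_orthant \<and>
     (\<forall>l\<in>pos_orthant. branching_mechanism c B \<mu> (\<phi> l) = l) \<and>
     (\<forall>l\<in>branching_domain c B \<mu>. \<phi> (branching_mechanism c B \<mu> l) = l) \<and>
     \<phi> differentiable_on pos_orthant \<and>
     branching_mechanism c B \<mu> differentiable_on branching_domain c B \<mu>"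

text \<open>
  The system \<open>v\<^sub>i' = a\<^sub>i - \<phi>\<^sub>i(v)\<close> on \<open>[0,\<infinity>)\<close> with \<open>v(0) = x\<close> and values in the closed orthant, where the
  derivative at time 0 is one-sided. A solution is differentiable, hence continuous and locally bounded;
  since the branching mechanism of admissible parameters is continuous on the closed orthant, it is then
  also continuously differentiable. These regularity properties are therefore not listed separately.
\<close>

definition branching_ode ::
  "real ^ 'd::finite \<Rightarrow> real ^ 'd ^ 'd \<Rightarrow> ('d \<Rightarrow> (real ^ 'd) measure) \<Rightarrow>
   real ^ 'd \<Rightarrow> real ^ 'd \<Rightarrow> (real \<Rightarrow> real ^ 'd) \<Rightarrow> bool"
where
  "branching_ode c B \<mu> a x v \<longleftrightarrow>
     v 0 = x \<and>
     (\<forall>t\<ge>0. 0 \<le> v t \<and>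
        (v has_vector_derivative (a - branching_mechanism c B \<mu> (v t))) (at t within {0..}))"

subsection \<open>Vectors with entries in \<open>[0,\<infinity>]\<close>\<close>

definition ennreal_vec :: "real ^ 'd::finite \<Rightarrow> ennreal ^ 'd" where
  "ennreal_vec x = (\<chi> j. ennreal (x $ j))"

text \<open>
  The limit at infinity is taken coordinatewise in \<open>ennreal\<close> because \<open>Lim\<close> needs a Hausdorff type class
  that the library does not instantiate for vectors over \<open>ennreal\<close>. It is meaningful only when the limit
  exists.
\<close>

definition ext_limit :: "(real \<Rightarrow> real ^ 'd::finite) \<Rightarrow> ennreal ^ 'd" where
  "ext_limit v = (\<chi> j. Lim at_top (\<lambda>t. ennreal (v t $ j)))"

subsection \<open>Irreducibility\<close>

definition mean_matrix :: "real ^ 'd ^ 'd \<Rightarrow> ('d::finite \<Rightarrow> (real ^ 'd) measure) \<Rightarrow> real ^ 'd ^ 'd" where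
  "mean_matrix B \<mu> =
     (\<chi> i j. B $ i $ j + (\<integral> z. max 0 (z $ i - (if i = j then 1 else 0)) \<partial>\<mu> j))"

text \<open>
  The index type carries no order, so the choice of a permutation matrix \<open>P\<close> is the choice of an enumeration
  \<open>\<sigma>\<close> of the indices: the entry of \<open>P\<^sup>T A P\<close> in row \<open>k\<close> and column \<open>l\<close> is \<open>A $ \<sigma> k $ \<sigma> l\<close>.
\<close>

definition reducible_matrix :: "real ^ 'd ^ 'd::finite \<Rightarrow> bool" where
  "reducible_matrix A \<longleftrightarrow>
     (\<exists>(\<sigma> :: nat \<Rightarrow> 'd) p.
        bij_betw \<sigma> {1..CARD('d)} UNIV \<and> 1 \<le> p \<and> p \<le> CARD('d) - 1 \<and>
        (\<forall>k\<in>{p+1..CARD('d)}. \<forall>l\<in>{1..p}. A $ \<sigma> k $ \<sigma> l = 0))"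

abbreviation irreducible_matrix :: "real ^ 'd ^ 'd::finite \<Rightarrow> bool" where
  "irreducible_matrix A \<equiv> \<not> reducible_matrix A"

subsection \<open>Multi-type CB processes\<close>

definition transition_semigroup :: "(real \<Rightarrow> real ^ 'd::finite \<Rightarrow> (real ^ 'd) measure) \<Rightarrow> bool" where
  "transition_semigroup P \<longleftrightarrow>
     (\<forall>t\<ge>0. P t \<in> measurable orthant_borel (prob_algebra orthant_borel)) \<and>
     (\<forall>x\<ge>0. P 0 x = return orthant_borel x) \<and>
     (\<forall>s\<ge>0. \<forall>t\<ge>0. \<forall>x\<ge>0. P (s + t) x = P s x \<bind> P t)"

definition cb_semigroup ::
  "real ^ 'd::finite \<Rightarrow> real ^ 'd ^ 'd \<Rightarrow> ('d \<Rightarrow> (real ^ 'd) measure) \<Rightarrow>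
   (real \<Rightarrow> real ^ 'd \<Rightarrow> (real ^ 'd) measure) \<Rightarrow> bool"
where
  "cb_semigroup c B \<mu> P \<longleftrightarrow>
     transition_semigroup P \<and>
     (\<exists>v. (\<forall>l\<ge>0. branching_ode c B \<mu> 0 l (\<lambda>t. v t l)) \<and>
          (\<forall>t\<ge>0. \<forall>x\<ge>0. \<forall>l\<ge>0. (\<integral> y. exp (- (l \<bullet> y)) \<partial>P t x) = exp (- (x \<bullet> v t l))))"

definition past_sigma ::
  "'w measure \<Rightarrow> (real \<Rightarrow> 'w \<Rightarrow> real ^ 'd::finite) \<Rightarrow> real \<Rightarrow> 'w measure"
where
  "past_sigma M Z s =
     sigma (space M) (\<Union>u\<in>{0..s}. {Z u -` A \<inter> space M | A. A \<in> sets orthant_borel})"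

definition markov_process ::
  "(real \<Rightarrow> real ^ 'd::finite \<Rightarrow> (real ^ 'd) measure) \<Rightarrow> 'w measure \<Rightarrow> (real \<Rightarrow> 'w \<Rightarrow> real ^ 'd) \<Rightarrow> bool"
where
  "markov_process P M Z \<longleftrightarrow>
     (\<forall>t\<ge>0. Z t \<in> measurable M orthant_borel) \<and>
     (\<forall>s\<ge>0. \<forall>t\<ge>0. \<forall>A\<in>sets orthant_borel.
        AE w in M. real_cond_exp M (past_sigma M Z s) (\<lambda>w. indicator A (Z (s + t) w)) w
                 = measure (P t (Z s w)) A)"

definition cadlag :: "(real \<Rightarrow> 'a::topological_space) \<Rightarrow> bool" where
  "cadlag f \<longleftrightarrow>
     (\<forall>t\<ge>0. (f \<longlongrightarrow> f t) (at_right t)) \<and> (\<forall>t>0. \<exists>y. (f \<longlongrightarrow> y) (at_left t))"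

text \<open>
  \<open>cb_process c B \<mu> x M Z\<close>: under the probability measure \<open>M\<close>, which plays the role of \<open>\<P>\<^sub>x\<close>, the process
  \<open>Z\<close> is a multi-type CB process with parameters \<open>(d, c, 0, B, 0, \<mu>)\<close> started from \<open>x\<close>.
\<close>

definition cb_process ::
  "real ^ 'd::finite \<Rightarrow> real ^ 'd ^ 'd \<Rightarrow> ('d \<Rightarrow> (real ^ 'd) measure) \<Rightarrow>
   real ^ 'd \<Rightarrow> 'w measure \<Rightarrow> (real \<Rightarrow> 'w \<Rightarrow> real ^ 'd) \<Rightarrow> bool"
where
  "cb_process c B \<mu> x M Z \<longleftrightarrow>
     prob_space M \<and>
     (\<exists>P. cb_semigroup c B \<mu> P \<and> markov_process P M Z) \<and>
     (\<forall>w\<in>space M. cadlag (\<lambda>t. Z t w)) \<and>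
     (AE w in M. Z 0 w = x)"

definition total_integral :: "(real \<Rightarrow> 'w \<Rightarrow> real ^ 'd::finite) \<Rightarrow> 'w \<Rightarrow> ennreal ^ 'd" where
  "total_integral Z w = (\<chi> j. \<integral>\<^sup>+ u\<in>{0..}. ennreal (Z u w $ j) \<partial>lborel)"

end

theory Submission
  imports Defs
begin

text \<open>
  Write \<open>\<phi>\<close> for the branching mechanism and \<open>y\<close> for the solution of \<open>y' = l - \<phi>(y)\<close>, \<open>y(0) = 0\<close>. Two properties of
  \<open>\<phi>\<close> on the closed orthant drive the deterministic claims: it is locally Lipschitz
  (\<open>branching_mechanism_lipschitz\<close>), and \<open>\<phi>\<^sub>i\<close> does not increase in the coordinates other than \<open>i\<close>
  (\<open>branching_mechanism_quasimonotone\<close>). For such a field, sub- and supersolutions stay ordered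
  (\<open>quasimonotone_comparison\<close>). Since \<open>y(s) \<ge> 0 = y(0)\<close>, comparing \<open>y\<close> with its time shift \<open>y(s + \<cdot>)\<close> shows that
  \<open>y\<close> increases. If \<open>y\<close> has a finite limit, then \<open>y'\<close> converges, necessarily to 0, so the limit is a zero of
  \<open>l - \<phi>\<close> and hence the image of \<open>l\<close> under the inverse of \<open>\<phi>\<close>.

  For positivity, let \<open>S\<close> be the set of coordinates in which \<open>y\<close> vanishes identically. For \<open>j\<close> in \<open>S\<close> the
  equation reads \<open>l\<^sub>j + (\<Sum>k. b\<^sub>k\<^sub>j y\<^sub>k) + (\<integral>z. 1 - exp (- y \<bullet> z) \<partial>\<mu>\<^sub>j) = 0\<close> with all terms nonnegative, so all of them vanish.
  Therefore the rows outside \<open>S\<close> of the mean matrix vanish on the columns in \<open>S\<close>, and irreducibility together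
  with \<open>l \<noteq> 0\<close> forces \<open>S\<close> to be empty (\<open>ext_limit_pos\<close>).

  The probabilistic claim rests on the bound \<open>E exp (- \<integral>\<^sub>0\<^sup>T l \<bullet> Z\<^sub>u du) \<le> exp (- x \<bullet> y(T))\<close> for a process started in
  \<open>x\<close> (\<open>cb_integral_laplace_le\<close>). Replace the integral by a Riemann sum of mesh \<open>h = T/n\<close>. Conditioning on the
  successive grid times and applying the Markov property, the Laplace transform of the Riemann sum is exactly
  \<open>exp (- x \<bullet> w\<^sub>n)\<close>, where \<open>w\<^sub>n\<close> is the \<open>n\<close>-fold iterate, started in 0, of "add \<open>h l\<close>, then follow the flow of
  \<open>- \<phi>\<close> for time \<open>h\<close>" (\<open>cb_laplace_riemann_sum\<close>). This is the splitting scheme for \<open>y' = l - \<phi>(y)\<close>, and the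
  comparison argument with an error term shows that asymptotically \<open>w\<^sub>n\<close> is not below \<open>y(T)\<close>
  (\<open>splitting_lower_bound\<close>). The Riemann sums converge because the paths are right-continuous and bounded on compact
  intervals, and Fatou's lemma gives the bound. If \<open>y\<^sub>i(T) \<rightarrow> \<infinity>\<close>, then for \<open>x = e\<^sub>i\<close> the right-hand side tends to 0,
  whereas the left-hand side stays bounded away from 0 if all total integrals are finite with positive
  probability (\<open>cb_total_integral_infinite\<close>).
\<close>

section \<open>Regularity and quasi-monotonicity of the branching mechanism\<close>

definition jump_integrand :: "real ^ 'd::finite \<Rightarrow> 'd \<Rightarrow> real ^ 'd \<Rightarrow> real" where
  "jump_integrand l i z = exp (- (l \<bullet> z)) - 1 + l $ i * min 1 (z $ i)"

text \<open>
  The function of \<open>z\<close> whose integrability with respect to \<open>\<mu>\<^sub>i\<close> is the admissibility condition.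
\<close>

definition jump_weight :: "'d::finite \<Rightarrow> real ^ 'd \<Rightarrow> real" where
  "jump_weight i z = min (norm z) ((norm z)\<^sup>2) + (\<Sum>j\<in>UNIV - {i}. min 1 (z $ j))"

lemma inner_nonneg_cart:
  fixes x y :: "real ^ 'd::finite"
  assumes "0 \<le> x" "0 \<le> y"
  shows "0 \<le> x \<bullet> y"
  using assms by (auto simp: inner_vec_def less_eq_vec_def intro!: sum_nonneg)

text \<open>
  The second bound is the one that matters near \<open>z = 0\<close>: after the linear part is removed, differences of the
  exponential are of second order, which is all that \<open>\<mu>\<^sub>i\<close> can integrate in the direction \<open>z\<^sub>i\<close>.
\<close>

lemma exp_minus_diff_bounds:
  fixes a b :: real
  assumes "0 \<le> a" "0 \<le> b"
  shows "\<bar>exp (- a) - exp (- b)\<bar> \<le> \<bar>a - b\<bar>"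
    and "\<bar>exp (- a) - exp (- b) + (a - b)\<bar> \<le> \<bar>a - b\<bar> * max a b"
proof -
  have *: "0 \<le> exp (- x) - exp (- y) \<and> exp (- x) - exp (- y) \<le> y - x \<and>
           (y - x) - (exp (- x) - exp (- y)) \<le> (y - x) * y" if "0 \<le> x" "x \<le> y" for x y :: real
  proof (cases "x = y")
    case False
    with that have "x < y" by simp
    obtain u where u: "x < u" "u < y" "exp (- y) - exp (- x) = (y - x) * (- exp (- u))"
      using MVT2[OF \<open>x < y\<close>, of "\<lambda>u. exp (- u)" "\<lambda>u. - exp (- u)"]
      by (force intro!: derivative_eq_intros)
    have "exp (- u) \<le> 1" "1 - exp (- u) \<le> y"
      using u that exp_ge_add_one_self[of "- u"] by auto
    then have "(y - x) * exp (- u) \<le> (y - x) * 1" "(y - x) * (1 - exp (- u)) \<le> (y - x) * y"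
      using that by (auto simp del: mult_1_right intro!: mult_left_mono)
    moreover have "0 \<le> (y - x) * exp (- u)" using that by simp
    ultimately show ?thesis using u(3) by (auto simp: algebra_simps)
  qed auto
  show "\<bar>exp (- a) - exp (- b)\<bar> \<le> \<bar>a - b\<bar>"
    using *[of a b] *[of b a] assms by (cases "a \<le> b") auto
  show "\<bar>exp (- a) - exp (- b) + (a - b)\<bar> \<le> \<bar>a - b\<bar> * max a b"
    using *[of a b] *[of b a] assms by (cases "a \<le> b") auto
qed

lemma jump_weight_nonneg:
  assumes "0 \<le> z"
  shows "0 \<le> jump_weight i z"
  using assms unfolding jump_weight_def less_eq_vec_def
  by (auto intro!: add_nonneg_nonneg sum_nonneg)

text \<open>
  On \<open>norm z \<le> 1\<close> the term \<open>l\<^sub>i min(1, z\<^sub>i)\<close> cancels the \<open>i\<close>-th part of the linear term of the exponential; the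
  other linear parts are controlled by the summands \<open>min(1, z\<^sub>j)\<close> and the quadratic remainder by \<open>(norm z)\<^sup>2\<close>.
  On \<open>norm z > 1\<close> the linear bound \<open>norm z\<close> suffices. Thus the Lipschitz constant of the integrand is a multiple of the
  weight, and integrability and the Lipschitz property of the branching mechanism both follow from this estimate.
\<close>

lemma jump_integrand_lipschitz:
  fixes l m z :: "real ^ 'd::finite"
  assumes l: "0 \<le> l" "norm l \<le> R" and m: "0 \<le> m" "norm m \<le> R" and z: "0 \<le> z"
  shows "\<bar>jump_integrand l i z - jump_integrand m i z\<bar> \<le> (2 + R) * norm (l - m) * jump_weight i z"
proof -
  define N where "N = norm (l - m)"
  have R: "0 \<le> R" using l(2) norm_ge_zero[of l] by linarith
  have z0: "\<And>j. 0 \<le> z $ j" using z by (auto simp: less_eq_vec_def)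
  have zn: "\<And>j. z $ j \<le> norm z" using component_le_norm_cart[of z] by (meson abs_le_D1)
  have N: "0 \<le> N" by (simp add: N_def)
  have lm: "\<And>j. \<bar>l $ j - m $ j\<bar> \<le> N"
    using component_le_norm_cart[of "l - m"] by (simp add: N_def)
  let ?a = "l \<bullet> z" and ?b = "m \<bullet> z" and ?S = "\<Sum>j\<in>UNIV - {i}. min 1 (z $ j)"
  have a: "0 \<le> ?a" "?a \<le> R * norm z"
    using inner_nonneg_cart[OF l(1) z] norm_cauchy_schwarz[of l z] mult_right_mono[OF l(2), of "norm z"]
    by auto
  have b: "0 \<le> ?b" "?b \<le> R * norm z"
    using inner_nonneg_cart[OF m(1) z] norm_cauchy_schwarz[of m z] mult_right_mono[OF m(2), of "norm z"]
    by auto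
  have ab: "\<bar>?a - ?b\<bar> \<le> N * norm z"
    using Cauchy_Schwarz_ineq2[of "l - m" z] by (simp add: N_def inner_diff_left)
  have S0: "0 \<le> ?S" using z0 by (auto intro!: sum_nonneg)
  have diff: "jump_integrand l i z - jump_integrand m i z
      = exp (- ?a) - exp (- ?b) + (l $ i - m $ i) * min 1 (z $ i)"
    by (simp add: jump_integrand_def algebra_simps)
  have "\<bar>exp (- ?a) - exp (- ?b) + (l $ i - m $ i) * min 1 (z $ i)\<bar> \<le> (2 + R) * N * jump_weight i z"
  proof (cases "norm z \<le> 1")
    case True
    have z1: "\<And>j. min 1 (z $ j) = z $ j" using zn True by (auto simp: min_def intro: order_trans antisym)
    \<comment> \<open>Isolate the coordinate \<open>i\<close>, whose linear contribution is cancelled by \<open>(l\<^sub>i - m\<^sub>i) min(1, z\<^sub>i)\<close>.\<close>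
    have split: "?a - ?b = (l $ i - m $ i) * z $ i + (\<Sum>j\<in>UNIV - {i}. (l $ j - m $ j) * z $ j)"
      by (simp add: inner_vec_def sum_subtractf[symmetric] algebra_simps sum.remove[of UNIV i])
    have "\<bar>\<Sum>j\<in>UNIV - {i}. (l $ j - m $ j) * z $ j\<bar> \<le> (\<Sum>j\<in>UNIV - {i}. N * z $ j)"
      by (rule order_trans[OF sum_abs], rule sum_mono) (auto simp: abs_mult z0 intro!: mult_right_mono lm)
    also have "\<dots> = N * ?S" by (simp add: z1 sum_distrib_left)
    finally have 1: "\<bar>\<Sum>j\<in>UNIV - {i}. (l $ j - m $ j) * z $ j\<bar> \<le> N * ?S" .
    have "\<bar>exp (- ?a) - exp (- ?b) + (?a - ?b)\<bar> \<le> \<bar>?a - ?b\<bar> * max ?a ?b"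
      by (rule exp_minus_diff_bounds(2)[OF a(1) b(1)])
    also have "\<dots> \<le> (N * norm z) * (R * norm z)"
      using a b ab N by (intro mult_mono) auto
    finally have 2: "\<bar>exp (- ?a) - exp (- ?b) + (?a - ?b)\<bar> \<le> R * N * (norm z)\<^sup>2"
      by (simp add: power2_eq_square algebra_simps)
    have w: "jump_weight i z = (norm z)\<^sup>2 + ?S"
      using True mult_left_le[of "norm z" "norm z"]
      by (simp add: jump_weight_def power2_eq_square min_absorb2)
    have "R * N * (norm z)\<^sup>2 + N * ?S \<le> (2 + R) * N * jump_weight i z"
      using S0 N R by (simp add: w algebra_simps add_nonneg_nonneg)
    then show ?thesis using 1 2 split by (simp add: z1)
  next
    case False
    have 1: "\<bar>exp (- ?a) - exp (- ?b)\<bar> \<le> N * norm z"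
      using exp_minus_diff_bounds(1)[OF a(1) b(1)] ab by simp
    have "\<bar>(l $ i - m $ i) * min 1 (z $ i)\<bar> \<le> N * norm z"
      unfolding abs_mult using lm[of i] zn[of i] z0[of i] N by (intro mult_mono) auto
    with 1 have "\<bar>exp (- ?a) - exp (- ?b) + (l $ i - m $ i) * min 1 (z $ i)\<bar> \<le> 2 * N * norm z" by linarith
    also have "\<dots> \<le> (2 + R) * N * jump_weight i z"
    proof (intro mult_mono)
      have "norm z \<le> (norm z)\<^sup>2" using False by (intro self_le_power) auto
      then show "norm z \<le> jump_weight i z" using S0 by (simp add: jump_weight_def)
    qed (use N R in \<open>auto intro!: mult_right_mono\<close>)
    finally show ?thesis .
  qed
  then show ?thesis using diff by (simp add: N_def)
qed

lemma borel_measurable_jump_measure: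
  assumes "admissible c \<beta> B \<nu> \<mu>" "f \<in> borel_measurable borel"
  shows "f \<in> borel_measurable (\<mu> i)"
proof -
  have "sets (\<mu> i) = sets punctured_orthant_borel" using assms(1) by (simp add: admissible_def)
  then show ?thesis
    using measurable_restrict_space1[OF assms(2)] by (subst measurable_cong_sets) auto
qed

lemma space_jump_measure:
  assumes "admissible c \<beta> B \<nu> \<mu>" "z \<in> space (\<mu> i)"
  shows "0 \<le> z"
proof -
  have "sets (\<mu> i) = sets punctured_orthant_borel" using assms(1) by (simp add: admissible_def)
  then have "space (\<mu> i) = {0..} - {0}"
    by (simp add: sets_eq_imp_space_eq[of "\<mu> i" punctured_orthant_borel] space_restrict_space)
  then show ?thesis using assms(2) by simp
qed

lemma integrable_jump_weight:
  assumes "admissible c \<beta> B \<nu> \<mu>"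
  shows "integrable (\<mu> i) (jump_weight i)"
proof (rule integrableI_nonneg)
  have [measurable]: "(\<lambda>z. z $ j) \<in> borel_measurable borel" for j :: 'a
    by (intro borel_measurable_continuous_onI continuous_intros)
  show "jump_weight i \<in> borel_measurable (\<mu> i)"
    by (rule borel_measurable_jump_measure[OF assms]) (simp add: jump_weight_def[abs_def])
  show "AE z in \<mu> i. 0 \<le> jump_weight i z"
    using space_jump_measure[OF assms] jump_weight_nonneg by blast
  show "(\<integral>\<^sup>+ z. ennreal (jump_weight i z) \<partial>\<mu> i) < \<infinity>"
    using assms by (simp add: admissible_def jump_weight_def)
qed

lemma integrable_jump_integrand:
  assumes adm: "admissible c \<beta> B \<nu> \<mu>" and l: "0 \<le> l"
  shows "integrable (\<mu> i) (jump_integrand l i)"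
proof (rule Bochner_Integration.integrable_bound)
  show "integrable (\<mu> i) (\<lambda>z. (2 + norm l) * norm l * jump_weight i z)"
    using integrable_jump_weight[OF adm] by simp
  have [measurable]: "(\<lambda>z. z $ j) \<in> borel_measurable borel" for j :: 'a
    by (intro borel_measurable_continuous_onI continuous_intros)
  show "jump_integrand l i \<in> borel_measurable (\<mu> i)"
    by (rule borel_measurable_jump_measure[OF adm]) (simp add: jump_integrand_def[abs_def])
  show "AE z in \<mu> i. norm (jump_integrand l i z) \<le> norm ((2 + norm l) * norm l * jump_weight i z)"
  proof (rule AE_I2)
    fix z assume "z \<in> space (\<mu> i)"
    then have z: "0 \<le> z" using space_jump_measure[OF adm] by blast
    have "\<bar>jump_integrand l i z - jump_integrand 0 i z\<bar> \<le> (2 + norm l) * norm (l - 0) * jump_weight i z"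
      by (rule jump_integrand_lipschitz) (use l z in auto)
    moreover have "jump_integrand 0 i z = 0" by (simp add: jump_integrand_def)
    ultimately show "norm (jump_integrand l i z) \<le> norm ((2 + norm l) * norm l * jump_weight i z)"
      by simp
  qed
qed

lemma branching_mechanism_nth:
  "branching_mechanism c B \<mu> l $ i =
     c $ i * (l $ i)\<^sup>2 - (\<Sum>k\<in>UNIV. B $ k $ i * l $ k) + (\<integral>z. jump_integrand l i z \<partial>\<mu> i)"
  by (simp add: branching_mechanism_def jump_integrand_def matrix_vector_mult_basis column_def
      inner_vec_def)

lemma branching_mechanism_lipschitz:
  assumes adm: "admissible c \<beta> B \<nu> \<mu>"
  obtains K where "0 \<le> K"
    "\<And>l m i. 0 \<le> l \<Longrightarrow> 0 \<le> m \<Longrightarrow> norm l \<le> R \<Longrightarrow> norm m \<le> R \<Longrightarrow>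
       \<bar>branching_mechanism c B \<mu> l $ i - branching_mechanism c B \<mu> m $ i\<bar> \<le> K * norm (l - m)"
proof (cases "0 \<le> R")
  case False
  show ?thesis
  proof (rule that[of 0])
    fix l m :: "real ^ 'a" and i
    assume "norm l \<le> R"
    then have False using False norm_ge_zero[of l] by linarith
    then show "\<bar>branching_mechanism c B \<mu> l $ i - branching_mechanism c B \<mu> m $ i\<bar> \<le> 0 * norm (l - m)" ..
  qed simp
next
  case R: True
  define Ki where "Ki i = \<bar>c $ i\<bar> * (2 * R) + (\<Sum>k\<in>UNIV. \<bar>B $ k $ i\<bar>)
      + (2 + R) * (\<integral>z. jump_weight i z \<partial>\<mu> i)" for i
  have J0: "0 \<le> (\<integral>z. jump_weight i z \<partial>\<mu> i)" for i
    using space_jump_measure[OF adm] jump_weight_nonneg by (intro integral_nonneg_AE AE_I2) blast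
  have Ki0: "0 \<le> Ki i" for i
    using R J0 by (auto simp: Ki_def intro!: add_nonneg_nonneg sum_nonneg)
  show ?thesis
  proof (rule that[of "\<Sum>i\<in>UNIV. Ki i"])
    show "0 \<le> (\<Sum>i\<in>UNIV. Ki i)" using Ki0 by (simp add: sum_nonneg)
    fix l m :: "real ^ 'a" and i
    assume l: "0 \<le> l" "norm l \<le> R" and m: "0 \<le> m" "norm m \<le> R"
    let ?N = "norm (l - m)"
    have lm: "\<bar>l $ j - m $ j\<bar> \<le> ?N" for j using component_le_norm_cart[of "l - m" j] by simp
    have li: "\<bar>l $ i + m $ i\<bar> \<le> 2 * R"
      using component_le_norm_cart[of l i] component_le_norm_cart[of m i] l m by linarith
    have "c $ i * (l $ i)\<^sup>2 - c $ i * (m $ i)\<^sup>2 = c $ i * ((l $ i + m $ i) * (l $ i - m $ i))"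
      by (simp add: power2_eq_square algebra_simps)
    moreover have "\<bar>(l $ i + m $ i) * (l $ i - m $ i)\<bar> \<le> (2 * R) * ?N"
      unfolding abs_mult by (intro mult_mono lm li) (use R in auto)
    ultimately have 1: "\<bar>c $ i * (l $ i)\<^sup>2 - c $ i * (m $ i)\<^sup>2\<bar> \<le> \<bar>c $ i\<bar> * (2 * R) * ?N"
      by (simp only: abs_mult[of "c $ i"] mult.assoc[of "\<bar>c $ i\<bar>"] mult_left_mono[OF _ abs_ge_zero])
    have "(\<Sum>k\<in>UNIV. B $ k $ i * l $ k) - (\<Sum>k\<in>UNIV. B $ k $ i * m $ k)
        = (\<Sum>k\<in>UNIV. B $ k $ i * (l $ k - m $ k))"
      by (simp add: sum_subtractf algebra_simps)
    also have "\<bar>\<dots>\<bar> \<le> (\<Sum>k\<in>UNIV. \<bar>B $ k $ i\<bar> * ?N)"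
      by (rule order_trans[OF sum_abs], rule sum_mono) (auto simp: abs_mult intro!: mult_left_mono lm)
    finally have 2: "\<bar>(\<Sum>k\<in>UNIV. B $ k $ i * l $ k) - (\<Sum>k\<in>UNIV. B $ k $ i * m $ k)\<bar>
        \<le> (\<Sum>k\<in>UNIV. \<bar>B $ k $ i\<bar>) * ?N" by (simp add: sum_distrib_right)
    note int = integrable_jump_integrand[OF adm l(1), of i] integrable_jump_integrand[OF adm m(1), of i]
    have "\<bar>(\<integral>z. jump_integrand l i z \<partial>\<mu> i) - (\<integral>z. jump_integrand m i z \<partial>\<mu> i)\<bar>
        = \<bar>\<integral>z. jump_integrand l i z - jump_integrand m i z \<partial>\<mu> i\<bar>"
      using int by simp
    also have "\<dots> \<le> (\<integral>z. \<bar>jump_integrand l i z - jump_integrand m i z\<bar> \<partial>\<mu> i)"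
      by (rule integral_abs_bound)
    also have "\<dots> \<le> (\<integral>z. (2 + R) * ?N * jump_weight i z \<partial>\<mu> i)"
    proof (rule integral_mono)
      show "integrable (\<mu> i) (\<lambda>z. (2 + R) * ?N * jump_weight i z)"
        using integrable_jump_weight[OF adm] by simp
      fix z assume "z \<in> space (\<mu> i)"
      then show "\<bar>jump_integrand l i z - jump_integrand m i z\<bar> \<le> (2 + R) * ?N * jump_weight i z"
        by (intro jump_integrand_lipschitz l m space_jump_measure[OF adm])
    qed (use int in auto)
    also have "\<dots> = (2 + R) * (\<integral>z. jump_weight i z \<partial>\<mu> i) * ?N" by simp
    finally have 3: "\<bar>(\<integral>z. jump_integrand l i z \<partial>\<mu> i) - (\<integral>z. jump_integrand m i z \<partial>\<mu> i)\<bar>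
        \<le> (2 + R) * (\<integral>z. jump_weight i z \<partial>\<mu> i) * ?N" .
    have "\<bar>branching_mechanism c B \<mu> l $ i - branching_mechanism c B \<mu> m $ i\<bar> \<le> Ki i * ?N"
      using 1 2 3 unfolding branching_mechanism_nth Ki_def distrib_right by linarith
    also have "\<dots> \<le> (\<Sum>i\<in>UNIV. Ki i) * ?N"
      by (intro mult_right_mono member_le_sum) (auto simp: Ki0)
    finally show "\<bar>branching_mechanism c B \<mu> l $ i - branching_mechanism c B \<mu> m $ i\<bar>
        \<le> (\<Sum>i\<in>UNIV. Ki i) * ?N" .
  qed
qed

text \<open>
  In \<open>\<phi>\<^sub>i\<close> a coordinate \<open>l\<^sub>k\<close> with \<open>k \<noteq> i\<close> occurs only in \<open>- b\<^sub>k\<^sub>i l\<^sub>k\<close>, where \<open>b\<^sub>k\<^sub>i \<ge> 0\<close>, and in \<open>exp (- l \<bullet> z)\<close>, where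
  \<open>z \<ge> 0\<close>.
\<close>

lemma branching_mechanism_quasimonotone:
  assumes adm: "admissible c \<beta> B \<nu> \<mu>" and x: "0 \<le> x" and xy: "x \<le> y" and eq: "x $ i = y $ i"
  shows "branching_mechanism c B \<mu> y $ i \<le> branching_mechanism c B \<mu> x $ i"
proof -
  have y: "0 \<le> y" using x xy by simp
  have "(\<Sum>k\<in>UNIV. B $ k $ i * x $ k) \<le> (\<Sum>k\<in>UNIV. B $ k $ i * y $ k)"
  proof (rule sum_mono)
    fix k show "B $ k $ i * x $ k \<le> B $ k $ i * y $ k"
      using adm xy eq by (cases "k = i") (auto simp: admissible_def less_eq_vec_def intro!: mult_left_mono)
  qed
  moreover have "(\<integral>z. jump_integrand y i z \<partial>\<mu> i) \<le> (\<integral>z. jump_integrand x i z \<partial>\<mu> i)"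
  proof (rule integral_mono[OF integrable_jump_integrand[OF adm y] integrable_jump_integrand[OF adm x]])
    fix z assume "z \<in> space (\<mu> i)"
    then have "0 \<le> z" by (rule space_jump_measure[OF adm])
    then have "x \<bullet> z \<le> y \<bullet> z"
      using inner_nonneg_cart[of "y - x" z] xy by (simp add: inner_diff_left)
    then show "jump_integrand y i z \<le> jump_integrand x i z" by (simp add: jump_integrand_def eq)
  qed
  ultimately show ?thesis by (simp add: branching_mechanism_nth eq)
qed

section \<open>Comparison for quasi-monotone differential inequalities\<close>

text \<open>
  The squared Euclidean distance of \<open>y\<close> to the set of vectors below \<open>x\<close>. Squares are used because \<open>(max 0 r)\<^sup>2\<close> is
  differentiable in \<open>r\<close>.
\<close>

definition excess :: "real ^ 'd::finite \<Rightarrow> real ^ 'd \<Rightarrow> real" where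
  "excess y x = (\<Sum>i\<in>UNIV. (max 0 (y $ i - x $ i))\<^sup>2)"

lemma excess_nonneg: "0 \<le> excess y x"
  by (simp add: excess_def sum_nonneg)

lemma excess_eq_0: "y \<le> x \<Longrightarrow> excess y x = 0"
  by (simp add: excess_def less_eq_vec_def max_absorb1)

lemma component_le_sqrt_excess: "y $ i - x $ i \<le> sqrt (excess y x)"
proof -
  have "(max 0 (y $ i - x $ i))\<^sup>2 \<le> excess y x"
    unfolding excess_def by (rule member_le_sum) auto
  then have "max 0 (y $ i - x $ i) \<le> sqrt (excess y x)" by (rule real_le_rsqrt)
  then show ?thesis by simp
qed

lemma has_derivative_pos_part_square:
  "((\<lambda>x::real. (max 0 x)\<^sup>2) has_field_derivative 2 * max 0 x) (at x)"
proof -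
  consider "x < 0" | "x = 0" | "0 < x" by linarith
  then show ?thesis
  proof cases
    case 1
    have "((\<lambda>x::real. 0) has_field_derivative 0) (at x)" by simp
    moreover have "\<forall>\<^sub>F y in nhds x. (0::real) = (max 0 y)\<^sup>2"
      using eventually_nhds_in_open[of "{..<0}" x] 1 by (auto elim!: eventually_mono)
    ultimately show ?thesis using 1 DERIV_cong_ev[of x x "\<lambda>x. 0" "\<lambda>x. (max 0 x)\<^sup>2" 0 0] by simp
  next
    case 2
    have "((\<lambda>h. (max 0 h)\<^sup>2 / h) \<longlongrightarrow> 0) (at (0::real))"
    proof (rule Lim_null_comparison)
      show "\<forall>\<^sub>F h in at (0::real). norm ((max 0 h)\<^sup>2 / h) \<le> \<bar>h\<bar>"
        by (intro always_eventually) (auto simp: max_def power2_eq_square abs_if)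
      show "((\<lambda>h. \<bar>h\<bar>) \<longlongrightarrow> 0) (at (0::real))" by (auto intro!: tendsto_eq_intros)
    qed
    then show ?thesis using 2 by (simp add: DERIV_def)
  next
    case 3
    have "((\<lambda>x::real. x\<^sup>2) has_field_derivative 2 * x) (at x)" by (auto intro!: derivative_eq_intros)
    moreover have "\<forall>\<^sub>F y in nhds x. y\<^sup>2 = (max 0 y)\<^sup>2"
      using eventually_nhds_in_open[of "{0<..}" x] 3 by (auto elim!: eventually_mono)
    ultimately show ?thesis
      using 3 DERIV_cong_ev[of x x "\<lambda>x. x\<^sup>2" "\<lambda>x. (max 0 x)\<^sup>2" "2 * x" "2 * x"] by simp
  qed
qed

lemma gronwall_affine:
  fixes G G' :: "real \<Rightarrow> real"
  assumes T: "0 \<le> T" and L: "0 \<le> L" and e: "0 \<le> e"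
    and G: "\<And>t. t \<in> {0..T} \<Longrightarrow> (G has_field_derivative G' t) (at t within {0..T})"
    and G': "\<And>t. t \<in> {0..T} \<Longrightarrow> G' t \<le> L * G t + e"
  shows "G T \<le> exp (L * T) * (G 0 + e * T)"
proof -
  \<comment> \<open>The integrating factor makes \<open>H\<close> nonincreasing because \<open>exp (- L t) e \<le> e\<close>.\<close>
  define H where "H t = exp (- (L * t)) * G t - e * t" for t
  have H: "(H has_field_derivative exp (- (L * t)) * (G' t - L * G t) - e) (at t within {0..T})"
    if "t \<in> {0..T}" for t
    unfolding H_def by (auto intro!: derivative_eq_intros G that simp: algebra_simps)
  have "H T \<le> H 0"
  proof (rule DERIV_nonpos_imp_decreasing_open[OF T])
    show "continuous_on {0..T} H" using H by (intro DERIV_continuous_on) auto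
    fix t assume t: "0 < t" "t < T"
    then have "at t within {0..T} = at t" by (intro at_within_interior) auto
    then have "(H has_field_derivative exp (- (L * t)) * (G' t - L * G t) - e) (at t)"
      using H[of t] t by auto
    moreover have "exp (- (L * t)) * (G' t - L * G t) \<le> 1 * e"
    proof -
      have "exp (- (L * t)) * (G' t - L * G t) \<le> exp (- (L * t)) * e"
        using G'[of t] t by (intro mult_left_mono) auto
      also have "\<dots> \<le> 1 * e" using e t L by (intro mult_right_mono) auto
      finally show ?thesis .
    qed
    ultimately show "\<exists>y. DERIV H t :> y \<and> y \<le> 0" by fastforce
  qed
  then have "exp (- (L * T)) * G T \<le> G 0 + e * T" by (simp add: H_def)
  then have "exp (L * T) * (exp (- (L * T)) * G T) \<le> exp (L * T) * (G 0 + e * T)"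
    by (rule mult_left_mono) simp
  then show ?thesis by (simp add: mult.assoc[symmetric] exp_add[symmetric])
qed

text \<open>
  Let \<open>Y\<close> be a subsolution up to an error \<open>\<delta>\<close> and \<open>X\<close> a supersolution of \<open>v' = a - f(v)\<close>. Where \<open>Y\<^sub>i > X\<^sub>i\<close>,
  quasi-monotonicity allows \<open>X\<close> to be replaced by the coordinatewise minimum \<open>m\<close> of \<open>X\<close> and \<open>Y\<close> in \<open>f\<^sub>i\<close>, since \<open>m\<close>
  agrees with \<open>X\<close> in coordinate \<open>i\<close>. As \<open>norm (Y - m)\<^sup>2\<close> is the excess itself, the Lipschitz estimate closes to a
  Gronwall inequality. Because \<open>m\<close> lies below \<open>Y\<close>, only \<open>Y\<close> has to satisfy an a priori bound.
\<close>

lemma quasimonotone_comparison: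
  fixes f :: "real ^ 'd::finite \<Rightarrow> real ^ 'd" and X Y X' Y' :: "real \<Rightarrow> real ^ 'd"
    and T K R \<delta> :: real
  assumes T: "0 \<le> T" and K: "0 \<le> K" and \<delta>: "0 \<le> \<delta>"
    and qm: "\<And>x y i. 0 \<le> x \<Longrightarrow> x \<le> y \<Longrightarrow> x $ i = y $ i \<Longrightarrow> f y $ i \<le> f x $ i"
    and lip: "\<And>x y i. 0 \<le> x \<Longrightarrow> 0 \<le> y \<Longrightarrow> norm x \<le> R \<Longrightarrow> norm y \<le> R \<Longrightarrow>
                \<bar>f x $ i - f y $ i\<bar> \<le> K * norm (x - y)"
    and Y: "\<And>t. t \<in> {0..T} \<Longrightarrow> 0 \<le> Y t" "\<And>t. t \<in> {0..T} \<Longrightarrow> norm (Y t) \<le> R"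
      "\<And>t. t \<in> {0..T} \<Longrightarrow> (Y has_vector_derivative Y' t) (at t within {0..T})"
      "\<And>t i. t \<in> {0..T} \<Longrightarrow> Y' t $ i \<le> a $ i - f (Y t) $ i + \<delta>"
    and X: "\<And>t. t \<in> {0..T} \<Longrightarrow> 0 \<le> X t"
      "\<And>t. t \<in> {0..T} \<Longrightarrow> (X has_vector_derivative X' t) (at t within {0..T})"
      "\<And>t i. t \<in> {0..T} \<Longrightarrow> a $ i - f (X t) $ i \<le> X' t $ i"
  shows "excess (Y T) (X T) \<le>
    exp ((K * (1 + CARD('d)) + 1) * T) * (excess (Y 0) (X 0) + CARD('d) * \<delta>\<^sup>2 * T)"
proof -
  define g where "g t i = max 0 (Y t $ i - X t $ i)" for t i
  define G' where "G' t = (\<Sum>i\<in>UNIV. 2 * g t i * (Y' t $ i - X' t $ i))" for t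
  have g0: "0 \<le> g t i" for t i by (simp add: g_def)
  have Gg: "excess (Y t) (X t) = (\<Sum>i\<in>UNIV. (g t i)\<^sup>2)" for t by (simp add: excess_def g_def)
  show ?thesis
  proof (rule gronwall_affine[OF T, where G' = G'])
    show "0 \<le> K * (1 + CARD('d)) + 1" "0 \<le> CARD('d) * \<delta>\<^sup>2" using K by auto
    fix t assume t: "t \<in> {0..T}"
    have comp: "((\<lambda>t. V t $ i) has_field_derivative V' $ i) (at t within {0..T})"
      if "(V has_vector_derivative V') (at t within {0..T})" for V :: "real \<Rightarrow> real ^ 'd" and V' i
      using bounded_linear.has_vector_derivative[OF bounded_linear_vec_nth that]
      by (simp add: has_real_derivative_iff_has_vector_derivative)
    have "((\<lambda>t. (max 0 (Y t $ i - X t $ i))\<^sup>2) has_field_derivative 2 * g t i * (Y' t $ i - X' t $ i))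
        (at t within {0..T})" for i
      unfolding g_def
      by (rule DERIV_chain2[OF has_derivative_pos_part_square])
        (intro derivative_intros comp X Y t)
    then show "((\<lambda>t. excess (Y t) (X t)) has_field_derivative G' t) (at t within {0..T})"
      unfolding excess_def G'_def by (intro derivative_intros)
    define m where "m = (\<chi> i. min (X t $ i) (Y t $ i))"
    have m: "0 \<le> m" "m \<le> X t" "m \<le> Y t"
      using X(1)[OF t] Y(1)[OF t] by (auto simp: m_def less_eq_vec_def)
    have "norm m \<le> norm (Y t)"
      using m by (intro norm_le_componentwise_cart) (auto simp: less_eq_vec_def abs_of_nonneg intro: order_trans)
    then have mR: "norm m \<le> R" using Y(2)[OF t] by linarith
    have nYm: "(norm (Y t - m))\<^sup>2 = excess (Y t) (X t)"
      unfolding Gg power2_norm_eq_inner inner_vec_def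
      by (intro sum.cong) (auto simp: m_def g_def max_def min_def power2_eq_square)
    have main: "2 * g t i * (Y' t $ i - X' t $ i) \<le>
        K * ((g t i)\<^sup>2 + excess (Y t) (X t)) + ((g t i)\<^sup>2 + \<delta>\<^sup>2)" for i
    proof (cases "X t $ i < Y t $ i")
      case True
      then have "m $ i = X t $ i" by (simp add: m_def)
      then have "f (X t) $ i \<le> f m $ i" using m by (intro qm) auto
      moreover have "\<bar>f m $ i - f (Y t) $ i\<bar> \<le> K * norm (m - Y t)"
        by (intro lip m Y t mR)
      ultimately have "Y' t $ i - X' t $ i \<le> K * norm (Y t - m) + \<delta>"
        using Y(4)[OF t, of i] X(3)[OF t, of i] by (simp add: norm_minus_commute)
      then have "2 * g t i * (Y' t $ i - X' t $ i) \<le> 2 * g t i * (K * norm (Y t - m) + \<delta>)"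
        using g0 by (intro mult_left_mono) auto
      also have "\<dots> = K * (2 * g t i * norm (Y t - m)) + 2 * g t i * \<delta>" by (simp add: algebra_simps)
      also have "\<dots> \<le> K * ((g t i)\<^sup>2 + (norm (Y t - m))\<^sup>2) + ((g t i)\<^sup>2 + \<delta>\<^sup>2)"
        using sum_squares_bound[of "g t i" "norm (Y t - m)"] sum_squares_bound[of "g t i" \<delta>] K
        by (intro add_mono mult_left_mono) auto
      finally show ?thesis by (simp add: nYm)
    next
      case False
      then show ?thesis using K excess_nonneg[of "Y t" "X t"] by (simp add: g_def)
    qed
    have "G' t \<le> (\<Sum>i\<in>UNIV. K * ((g t i)\<^sup>2 + excess (Y t) (X t)) + ((g t i)\<^sup>2 + \<delta>\<^sup>2))"
      unfolding G'_def by (intro sum_mono main)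
    also have "\<dots> = (K * (1 + CARD('d)) + 1) * excess (Y t) (X t) + CARD('d) * \<delta>\<^sup>2"
      by (simp add: sum.distrib sum_distrib_left[symmetric] Gg[symmetric] algebra_simps)
    finally show "G' t \<le> (K * (1 + CARD('d)) + 1) * excess (Y t) (X t) + CARD('d) * \<delta>\<^sup>2" .
  qed
qed


section \<open>Solutions of the branching equation and their limits\<close>

lemma branching_odeD:
  assumes "branching_ode c B \<mu> a x v"
  shows "v 0 = x" "\<And>t. 0 \<le> t \<Longrightarrow> 0 \<le> v t"
    "\<And>t. 0 \<le> t \<Longrightarrow> (v has_vector_derivative (a - branching_mechanism c B \<mu> (v t))) (at t within {0..})"
  using assms by (auto simp: branching_ode_def)

lemma branching_ode_continuous_on:
  assumes "branching_ode c B \<mu> a x v"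
  shows "continuous_on {0..} v"
  using branching_odeD(3)[OF assms]
  by (intro continuous_on_vector_derivative) auto

lemma branching_ode_bounded:
  assumes "branching_ode c B \<mu> a x v"
  obtains R where "\<And>t. t \<in> {0..T::real} \<Longrightarrow> norm (v t) \<le> R"
proof -
  have "compact (v ` {0..T})"
    by (rule compact_continuous_image[OF continuous_on_subset[OF branching_ode_continuous_on[OF assms]]]) auto
  then have "bounded (v ` {0..T})" by (rule compact_imp_bounded)
  then show ?thesis using that unfolding bounded_iff by blast
qed

lemma branching_ode_shift:
  assumes v: "branching_ode c B \<mu> a x v" and s: "0 \<le> s"
  shows "branching_ode c B \<mu> a (v s) (\<lambda>t. v (s + t))"
  unfolding branching_ode_def
proof (intro conjI allI impI)
  fix t :: real assume t: "0 \<le> t"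
  then show "0 \<le> v (s + t)" using branching_odeD(2)[OF v] s by simp
  have "((v \<circ> (\<lambda>t. s + t)) has_vector_derivative
      1 *\<^sub>R (a - branching_mechanism c B \<mu> (v (s + t)))) (at t within {0..})"
  proof (rule vector_diff_chain_within)
    show "((\<lambda>t. s + t) has_vector_derivative 1) (at t within {0..})"
      by (auto intro!: derivative_eq_intros)
    show "(v has_vector_derivative (a - branching_mechanism c B \<mu> (v (s + t))))
        (at (s + t) within (\<lambda>t. s + t) ` {0..})"
      by (rule has_vector_derivative_within_subset[OF branching_odeD(3)[OF v]]) (use s t in auto)
  qed
  then show "((\<lambda>t. v (s + t)) has_vector_derivative a - branching_mechanism c B \<mu> (v (s + t)))
      (at t within {0..})" by (simp add: comp_def)
qed simp

lemma branching_ode_mono: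
  fixes v w :: "real \<Rightarrow> real ^ 'd::finite" and T :: real
  assumes adm: "admissible c \<beta> B \<nu> \<mu>"
    and v: "branching_ode c B \<mu> a x v" and w: "branching_ode c B \<mu> a y w"
    and xy: "x \<le> y" and T: "0 \<le> T"
  shows "v T \<le> w T"
proof -
  obtain R where R: "\<And>t. t \<in> {0..T} \<Longrightarrow> norm (v t) \<le> R"
    using branching_ode_bounded[OF v] by blast
  obtain K where K: "0 \<le> K"
    "\<And>l m i. 0 \<le> l \<Longrightarrow> 0 \<le> m \<Longrightarrow> norm l \<le> R \<Longrightarrow> norm m \<le> R \<Longrightarrow>
       \<bar>branching_mechanism c B \<mu> l $ i - branching_mechanism c B \<mu> m $ i\<bar> \<le> K * norm (l - m)"
    using branching_mechanism_lipschitz[OF adm] by blast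
  note der = has_vector_derivative_within_subset[OF branching_odeD(3)]
  have "excess (v T) (w T) \<le> exp ((K * (1 + CARD('d)) + 1) * T) * (excess (v 0) (w 0) + CARD('d) * (0::real)\<^sup>2 * T)"
    by (rule quasimonotone_comparison[where R = R and a = a and f = "branching_mechanism c B \<mu>"])
      (auto intro!: T K R branching_mechanism_quasimonotone[OF adm] branching_odeD(2)[OF v]
        branching_odeD(2)[OF w] der[OF v] der[OF w])
  also have "excess (v 0) (w 0) = 0"
    using xy branching_odeD(1)[OF v] branching_odeD(1)[OF w] by (simp add: excess_eq_0)
  finally have "excess (v T) (w T) = 0" using excess_nonneg[of "v T" "w T"] by simp
  then show ?thesis
    using component_le_sqrt_excess[of "v T" _ "w T"] by (simp add: less_eq_vec_def)
qed

text \<open>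
  The shifted solution \<open>v(t - s + \<cdot>)\<close> starts above \<open>v(0) = 0\<close>, so it dominates \<open>v\<close> at time \<open>s\<close>.
\<close>

lemma branching_ode_increasing:
  assumes adm: "admissible c \<beta> B \<nu> \<mu>" and v: "branching_ode c B \<mu> a 0 v"
    and s: "0 \<le> s" and st: "s \<le> t"
  shows "v s \<le> v t"
  using branching_ode_mono[OF adm v branching_ode_shift[OF v, of "t - s"]
      branching_odeD(2)[OF v, of "t - s"] s] st by simp

lemma branching_ode_component_deriv:
  assumes v: "branching_ode c B \<mu> a x v" and t: "0 < t"
  shows "((\<lambda>t. v t $ i) has_field_derivative a $ i - branching_mechanism c B \<mu> (v t) $ i) (at t)"
proof -
  have "at t within {0..} = at t" using t by (intro at_within_interior) auto
  then have "(v has_vector_derivative (a - branching_mechanism c B \<mu> (v t))) (at t)"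
    using branching_odeD(3)[OF v, of t] t by simp
  from bounded_linear.has_vector_derivative[OF bounded_linear_vec_nth this, of i]
  show ?thesis by (simp add: has_real_derivative_iff_has_vector_derivative)
qed

lemma ext_limit_increasing:
  fixes v :: "real \<Rightarrow> real ^ 'd::finite"
  assumes mono: "\<And>s t. 0 \<le> s \<Longrightarrow> s \<le> t \<Longrightarrow> v s \<le> v t"
  shows "((\<lambda>t. ennreal (v t $ j)) \<longlongrightarrow> ext_limit v $ j) at_top"
    and "0 \<le> t \<Longrightarrow> ennreal (v t $ j) \<le> ext_limit v $ j"
proof -
  let ?S = "SUP t\<in>{0..}. ennreal (v t $ j)"
  have lim: "((\<lambda>t. ennreal (v t $ j)) \<longlongrightarrow> ?S) at_top"
  proof (rule increasing_tendsto)
    show "\<forall>\<^sub>F t in at_top. ennreal (v t $ j) \<le> ?S"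
      using eventually_ge_at_top[of 0] by eventually_elim (auto intro: SUP_upper)
    fix x assume "x < ?S"
    then obtain s where s: "0 \<le> s" "x < ennreal (v s $ j)" by (auto simp: less_SUP_iff)
    show "\<forall>\<^sub>F t in at_top. x < ennreal (v t $ j)"
      using eventually_ge_at_top[of s]
    proof eventually_elim
      case (elim t)
      then have "v s $ j \<le> v t $ j" using mono[OF s(1)] by (simp add: less_eq_vec_def)
      then show ?case using s(2) by (auto intro: order_less_le_trans ennreal_leI)
    qed
  qed
  then have eq: "ext_limit v $ j = ?S" by (simp add: ext_limit_def tendsto_Lim)
  show "((\<lambda>t. ennreal (v t $ j)) \<longlongrightarrow> ext_limit v $ j) at_top" using lim eq by simp
  show "0 \<le> t \<Longrightarrow> ennreal (v t $ j) \<le> ext_limit v $ j" unfolding eq by (rule SUP_upper) simp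
qed

lemma ennreal_vec_tendsto_ext_limit:
  assumes "\<And>s t. 0 \<le> s \<Longrightarrow> s \<le> t \<Longrightarrow> v s \<le> v t"
  shows "((\<lambda>t. ennreal_vec (v t)) \<longlongrightarrow> ext_limit v) at_top"
  using ext_limit_increasing(1)[OF assms] by (intro vec_tendstoI) (simp add: ennreal_vec_def)

text \<open>
  An enumeration that lists \<open>S\<close> before its complement exhibits the zero block.
\<close>

lemma reducible_matrix_block:
  fixes A :: "real ^ 'd ^ 'd::finite"
  assumes S: "S \<noteq> {}" "S \<noteq> UNIV" and zero: "\<And>k j. k \<notin> S \<Longrightarrow> j \<in> S \<Longrightarrow> A $ k $ j = 0"
  shows "reducible_matrix A"
proof -
  define p where "p = card S"
  have p: "1 \<le> p" "p < CARD('d)"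
    using S psubset_card_mono[of UNIV S] by (auto simp: p_def Suc_le_eq card_gt_0_iff)
  obtain f where f: "bij_betw f {1..p} S"
    using ex_bij_betw_nat_finite_1[of S] by (auto simp: p_def)
  obtain g where g: "bij_betw g {p+1..CARD('d)} (- S)"
  proof -
    have "card (- S) = card {p+1..CARD('d)}"
      unfolding Compl_eq_Diff_UNIV using p by (subst card_Diff_subset) (auto simp: p_def)
    then show ?thesis using that bij_betw_iff_card[of "{p+1..CARD('d)}" "- S"] by auto
  qed
  define \<sigma> where "\<sigma> k = (if k \<in> {1..p} then f k else g k)" for k
  have s1: "bij_betw \<sigma> {1..p} S"
    using f by (rule bij_betw_cong[THEN iffD1, rotated]) (simp add: \<sigma>_def)
  have s2: "bij_betw \<sigma> {p+1..CARD('d)} (- S)"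
    using g by (rule bij_betw_cong[THEN iffD1, rotated]) (simp add: \<sigma>_def)
  have "bij_betw \<sigma> ({1..p} \<union> {p+1..CARD('d)}) (S \<union> - S)"
    by (rule bij_betw_combine[OF s1 s2]) auto
  moreover have "{1..p} \<union> {p+1..CARD('d)} = {1..CARD('d)}" using p by auto
  ultimately have "bij_betw \<sigma> {1..CARD('d)} UNIV" by simp
  moreover have "A $ \<sigma> k $ \<sigma> l = 0" if "k \<in> {p+1..CARD('d)}" "l \<in> {1..p}" for k l
    using that bij_betwE[OF s1] bij_betwE[OF s2] by (intro zero) auto
  ultimately show ?thesis unfolding reducible_matrix_def using p by (intro exI[of _ \<sigma>] exI[of _ p]) auto
qed

text \<open>
  The coordinates in which the solution vanishes identically index a zero block of the mean matrix: in such a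
  coordinate the equation is a vanishing sum of nonnegative terms. Positivity at one time persists in the limit
  because the solution increases.
\<close>

lemma ext_limit_pos:
  fixes v :: "real \<Rightarrow> real ^ 'd::finite"
  assumes adm: "admissible c \<beta> B \<nu> \<mu>" and v: "branching_ode c B \<mu> l 0 v"
    and l: "0 \<le> l" "l \<noteq> 0" and irr: "irreducible_matrix (mean_matrix B \<mu>)"
  shows "0 < ext_limit v $ j"
proof -
  define S where "S = {j. \<forall>t\<ge>0. v t $ j = 0}"
  have v0: "0 \<le> v t $ k" if "0 \<le> t" for t k
    using branching_odeD(2)[OF v that] by (simp add: less_eq_vec_def)
  have l0: "0 \<le> l $ k" for k using l(1) by (simp add: less_eq_vec_def)
  have J: "integrable (\<mu> j) (jump_integrand (v t) j)" if "0 \<le> t" for t j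
    by (rule integrable_jump_integrand[OF adm branching_odeD(2)[OF v that]])
  have key: "l $ j = 0 \<and> (\<forall>k. B $ k $ j * v t $ k = 0) \<and> (AE z in \<mu> j. v t \<bullet> z = 0)"
    if j: "j \<in> S" and t: "0 < t" for j t
  proof -
    have vj: "v t $ j = 0" using j t by (simp add: S_def)
    have "((\<lambda>t. v t $ j) has_field_derivative 0) (at t)"
    proof (rule has_field_derivative_transform_within_open[of "\<lambda>_. 0" _ _ "{0<..}"])
      show "0 = v x $ j" if "x \<in> {0<..}" for x using that j by (simp add: S_def)
    qed (use t in auto)
    then have "l $ j - branching_mechanism c B \<mu> (v t) $ j = 0"
      by (rule DERIV_unique[OF branching_ode_component_deriv[OF v t]])
    then have sum: "l $ j + (\<Sum>k\<in>UNIV. B $ k $ j * v t $ k) + (\<integral>z. - jump_integrand (v t) j z \<partial>\<mu> j) = 0"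
      by (simp add: branching_mechanism_nth vj)
    have Bv: "0 \<le> B $ k $ j * v t $ k" for k
      using adm vj v0[of t k] t by (cases "k = j") (auto simp: admissible_def)
    have jump: "- jump_integrand (v t) j z = 1 - exp (- (v t \<bullet> z))" for z
      by (simp add: jump_integrand_def vj)
    have jump0: "0 \<le> - jump_integrand (v t) j z" if "z \<in> space (\<mu> j)" for z
      using inner_nonneg_cart[OF branching_odeD(2)[OF v, of t] space_jump_measure[OF adm that]] t
      by (simp add: jump)
    have I0: "0 \<le> (\<integral>z. - jump_integrand (v t) j z \<partial>\<mu> j)"
      by (rule Bochner_Integration.integral_nonneg) (rule jump0)
    have B0: "0 \<le> (\<Sum>k\<in>UNIV. B $ k $ j * v t $ k)" by (intro sum_nonneg Bv)
    have "(\<integral>z. - jump_integrand (v t) j z \<partial>\<mu> j) = 0" using sum I0 B0 l0[of j] by linarith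
    moreover have "integrable (\<mu> j) (\<lambda>z. - jump_integrand (v t) j z)" using J[of t j] t by simp
    ultimately have "AE z in \<mu> j. - jump_integrand (v t) j z = 0"
      using jump0 by (subst (asm) integral_nonneg_eq_0_iff_AE) auto
    then have "AE z in \<mu> j. v t \<bullet> z = 0" by (simp add: jump)
    moreover have "(\<Sum>k\<in>UNIV. B $ k $ j * v t $ k) = 0" using sum I0 B0 l0[of j] by linarith
    then have "\<forall>k. B $ k $ j * v t $ k = 0" using Bv by (subst (asm) sum_nonneg_eq_0_iff) auto
    ultimately show ?thesis using sum I0 B0 l0[of j] by auto
  qed
  have "S \<noteq> UNIV"
  proof
    assume "S = UNIV"
    then have "l = 0" using key[of _ 1] by (simp add: vec_eq_iff)
    with l(2) show False by simp
  qed
  moreover have "mean_matrix B \<mu> $ k $ j = 0" if k: "k \<notin> S" and j: "j \<in> S" for k j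
  proof -
    obtain t where t: "0 \<le> t" "v t $ k \<noteq> 0" using k by (auto simp: S_def)
    have "t \<noteq> 0" using t branching_odeD(1)[OF v] by auto
    with t have t0: "0 < t" and vk: "0 < v t $ k" using v0[of t k] by auto
    have "B $ k $ j = 0" using key[OF j t0] vk by auto
    moreover have "(\<integral>z. max 0 (z $ k - (if k = j then 1 else 0)) \<partial>\<mu> j) = (\<integral>z. 0 \<partial>\<mu> j)"
    proof (rule Bochner_Integration.integral_cong_AE)
      have [measurable]: "(\<lambda>z. z $ k) \<in> borel_measurable borel"
        by (intro borel_measurable_continuous_onI continuous_intros)
      show "(\<lambda>z. max 0 (z $ k - (if k = j then 1 else 0))) \<in> borel_measurable (\<mu> j)"
        by (rule borel_measurable_jump_measure[OF adm]) simp
      have "AE z in \<mu> j. v t \<bullet> z = 0" using key[OF j t0] by blast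
      with AE_space show "AE z in \<mu> j. max 0 (z $ k - (if k = j then 1 else 0)) = 0"
      proof eventually_elim
        case (elim z)
        then have z: "0 \<le> z" by (blast intro: space_jump_measure[OF adm])
        then have "\<And>i. 0 \<le> v t $ i * z $ i" using v0 t by (simp add: less_eq_vec_def)
        moreover have "(\<Sum>i\<in>UNIV. v t $ i * z $ i) = 0" using elim by (simp add: inner_vec_def)
        ultimately have "v t $ k * z $ k = 0" by (subst (asm) sum_nonneg_eq_0_iff) auto
        then show ?case using vk by simp
      qed
    qed simp
    ultimately show ?thesis by (simp add: mean_matrix_def)
  qed
  ultimately have "S = {}" using reducible_matrix_block[of S "mean_matrix B \<mu>"] irr by blast
  then obtain t where t: "0 \<le> t" "v t $ j \<noteq> 0" by (auto simp: S_def)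
  then have "0 < ennreal (v t $ j)" using v0[of t j] by simp
  also have "\<dots> \<le> ext_limit v $ j"
    using branching_ode_increasing[OF adm v] t by (intro ext_limit_increasing(2)) auto
  finally show ?thesis .
qed

text \<open>
  By the mean value theorem \<open>f(t + 1) - f(t)\<close> is a value of the derivative at a point beyond \<open>t\<close>, and it tends to 0.
\<close>

lemma tendsto_deriv_at_top_eq_0:
  fixes f f' :: "real \<Rightarrow> real"
  assumes der: "\<And>t. 0 < t \<Longrightarrow> (f has_field_derivative f' t) (at t)"
    and f: "(f \<longlongrightarrow> a) at_top" and f': "(f' \<longlongrightarrow> b) at_top"
  shows "b = 0"
proof -
  have "\<exists>\<xi>. t < \<xi> \<and> f (t + 1) - f t = f' \<xi>" if "0 < t" for t
    using MVT2[of t "t + 1" f f'] der that by force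
  then obtain \<xi> where \<xi>: "0 < t \<Longrightarrow> t < \<xi> t \<and> f (t + 1) - f t = f' (\<xi> t)" for t by metis
  have "filterlim \<xi> at_top at_top"
  proof (rule filterlim_at_top_mono[OF filterlim_ident])
    show "\<forall>\<^sub>F t in at_top. t \<le> \<xi> t"
      using eventually_gt_at_top[of 0] by eventually_elim (use \<xi> in force)
  qed
  then have "((\<lambda>t. f' (\<xi> t)) \<longlongrightarrow> b) at_top" by (rule filterlim_compose[OF f'])
  moreover have "((\<lambda>t. f (t + 1) - f t) \<longlongrightarrow> a - a) at_top"
  proof (intro tendsto_diff f filterlim_compose[OF f])
    show "filterlim (\<lambda>t::real. t + 1) at_top at_top"
      by (rule filterlim_at_top_mono[OF filterlim_ident]) simp
  qed
  moreover have "\<forall>\<^sub>F t in at_top. f (t + 1) - f t = f' (\<xi> t)"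
    using eventually_gt_at_top[of 0] by eventually_elim (use \<xi> in force)
  ultimately have "((\<lambda>t. f' (\<xi> t)) \<longlongrightarrow> 0) at_top" using tendsto_cong by force
  then show ?thesis
    using tendsto_unique[OF _ \<open>((\<lambda>t. f' (\<xi> t)) \<longlongrightarrow> b) at_top\<close>] by simp
qed

lemma branching_ode_limit_equilibrium:
  fixes v :: "real \<Rightarrow> real ^ 'd::finite"
  assumes adm: "admissible c \<beta> B \<nu> \<mu>" and v: "branching_ode c B \<mu> a x v"
    and lim: "(v \<longlongrightarrow> L) at_top"
  shows "branching_mechanism c B \<mu> L = a"
proof -
  have ev0: "\<forall>\<^sub>F t in at_top. 0 \<le> v t"
    using eventually_ge_at_top[of 0] by eventually_elim (rule branching_odeD(2)[OF v])
  have "0 \<le> L $ i" for i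
  proof (rule tendsto_lowerbound[OF tendsto_vec_nth[OF lim]])
    show "\<forall>\<^sub>F t in at_top. 0 \<le> v t $ i" using ev0 by eventually_elim (simp add: less_eq_vec_def)
  qed simp
  then have L0: "0 \<le> L" by (simp add: less_eq_vec_def)
  obtain K where "0 \<le> K" and K: "\<And>l m i. 0 \<le> l \<Longrightarrow> 0 \<le> m \<Longrightarrow> norm l \<le> norm L + 1 \<Longrightarrow> norm m \<le> norm L + 1 \<Longrightarrow>
       \<bar>branching_mechanism c B \<mu> l $ i - branching_mechanism c B \<mu> m $ i\<bar> \<le> K * norm (l - m)"
    using branching_mechanism_lipschitz[OF adm, of "norm L + 1"] by blast
  have "\<forall>\<^sub>F t in at_top. norm (v t) < norm L + 1"
    by (rule order_tendstoD(2)[OF tendsto_norm[OF lim]]) simp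
  then have bound: "\<forall>\<^sub>F t in at_top. norm (branching_mechanism c B \<mu> (v t) $ i - branching_mechanism c B \<mu> L $ i)
      \<le> K * norm (v t - L)" for i
    using ev0
  proof eventually_elim
    case (elim t)
    then show ?case using K[of "v t" L i] L0 by simp
  qed
  have "((\<lambda>t. branching_mechanism c B \<mu> (v t) $ i) \<longlongrightarrow> branching_mechanism c B \<mu> L $ i) at_top" for i
  proof (rule LIM_zero_cancel, rule Lim_null_comparison[OF bound])
    show "((\<lambda>t. K * norm (v t - L)) \<longlongrightarrow> 0) at_top"
      using lim by (intro tendsto_mult_right_zero tendsto_norm_zero) (simp add: LIM_zero_iff)
  qed
  then have *: "((\<lambda>t. a $ i - branching_mechanism c B \<mu> (v t) $ i) \<longlongrightarrow> a $ i - branching_mechanism c B \<mu> L $ i) at_top" for i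
    by (rule tendsto_diff[OF tendsto_const])
  have "a $ i - branching_mechanism c B \<mu> L $ i = 0" for i
  proof (rule tendsto_deriv_at_top_eq_0[where f = "\<lambda>t. v t $ i", OF _ _ *])
    show "((\<lambda>t. v t $ i) \<longlongrightarrow> L $ i) at_top" by (rule tendsto_vec_nth[OF lim])
  qed (rule branching_ode_component_deriv[OF v])
  then show ?thesis by (simp add: vec_eq_iff)
qed

lemma ext_limit_eq_branching_inverse:
  fixes v :: "real \<Rightarrow> real ^ 'd::finite"
  assumes adm: "admissible c \<beta> B \<nu> \<mu>" and v: "branching_ode c B \<mu> l 0 v"
    and l: "l \<in> pos_orthant" and \<phi>: "branching_inverse c B \<mu> \<phi>"
    and fin: "\<And>j. ext_limit v $ j < \<infinity>"
  shows "ext_limit v = ennreal_vec (\<phi> l)"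
proof -
  define L where "L = (\<chi> j. enn2real (ext_limit v $ j))"
  have ext: "ext_limit v $ j = ennreal (L $ j)" for j
    using fin[of j] by (simp add: L_def less_top)
  have L0: "0 \<le> L" by (simp add: L_def less_eq_vec_def)
  have "(v \<longlongrightarrow> L) at_top"
  proof (rule vec_tendstoI)
    fix j
    have "((\<lambda>t. ennreal (v t $ j)) \<longlongrightarrow> ennreal (L $ j)) at_top"
      using ext_limit_increasing(1)[of v j] branching_ode_increasing[OF adm v] by (simp add: ext)
    then show "((\<lambda>t. v t $ j) \<longlongrightarrow> L $ j) at_top"
    proof (rule tendsto_ennrealD)
      show "\<forall>\<^sub>F t in at_top. 0 \<le> v t $ j"
        using eventually_ge_at_top[of 0]
        by eventually_elim (use branching_odeD(2)[OF v] in \<open>auto simp: less_eq_vec_def\<close>)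
    qed (use L0 in \<open>auto simp: less_eq_vec_def\<close>)
  qed
  then have eq: "branching_mechanism c B \<mu> L = l" by (rule branching_ode_limit_equilibrium[OF adm v])
  then have "L \<in> branching_domain c B \<mu>"
    using L0 l by (simp add: branching_domain_def pos_orthant_def)
  then have "\<phi> (branching_mechanism c B \<mu> L) = L" using \<phi> unfolding branching_inverse_def by blast
  then have "\<phi> l = L" by (simp only: eq)
  then show ?thesis by (simp add: vec_eq_iff ennreal_vec_def ext)
qed


section \<open>A lower bound for the splitting scheme\<close>

text \<open>
  One step of the scheme starts at \<open>w + h l\<close> and follows the flow of \<open>- \<phi>\<close>. It is compared with
  \<open>Y(s) = y(u + s) + (h - s) l\<close>, in which the input that \<open>y\<close> still has to receive before time \<open>u + h\<close> is added in
  advance. Then \<open>Y' = - \<phi>(y(u + s))\<close>, so \<open>Y\<close> satisfies the same equation as the flow up to an error of order \<open>h\<close>,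
  it stays in the orthant, and the excess at both ends is the excess of \<open>y\<close> over the scheme.
\<close>

lemma splitting_step:
  fixes y X :: "real \<Rightarrow> real ^ 'd::finite" and K R T h u :: real
  assumes adm: "admissible c \<beta> B \<nu> \<mu>" and l: "0 \<le> l"
    and y: "branching_ode c B \<mu> l 0 y"
    and X: "branching_ode c B \<mu> 0 (w + h *\<^sub>R l) X"
    and h: "0 \<le> h" "h \<le> T" and u: "0 \<le> u" "u + h \<le> T"
    and R: "\<And>t. t \<in> {0..T} \<Longrightarrow> norm (y t) + T * norm l \<le> R"
    and K: "0 \<le> K"
    and lip: "\<And>l m i. 0 \<le> l \<Longrightarrow> 0 \<le> m \<Longrightarrow> norm l \<le> R \<Longrightarrow> norm m \<le> R \<Longrightarrow>
       \<bar>branching_mechanism c B \<mu> l $ i - branching_mechanism c B \<mu> m $ i\<bar> \<le> K * norm (l - m)"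
  shows "excess (y (u + h)) (X h) \<le>
    exp ((K * (1 + CARD('d)) + 1) * h) * (excess (y u) w + CARD('d) * (K * (h * norm l))\<^sup>2 * h)"
proof -
  define Y where "Y s = y (u + s) + (h - s) *\<^sub>R l" for s
  have Y0: "0 \<le> Y s" if "s \<in> {0..h}" for s
    using branching_odeD(2)[OF y, of "u + s"] that u l unfolding Y_def
    by (intro add_nonneg_nonneg scaleR_nonneg_nonneg) auto
  have small: "norm ((h - s) *\<^sub>R l) \<le> h * norm l" if "s \<in> {0..h}" for s
    using that by (auto intro: mult_right_mono)
  have Tl: "h * norm l \<le> T * norm l" using h by (intro mult_right_mono) auto
  have nY: "norm (Y s) \<le> R" if "s \<in> {0..h}" for s
    using norm_triangle_ineq[of "y (u + s)" "(h - s) *\<^sub>R l"] small[OF that] R[of "u + s"] that u Tl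
    by (simp add: Y_def)
  have ny: "norm (y (u + s)) \<le> R" if "s \<in> {0..h}" for s
  proof -
    have "0 \<le> T * norm l" using h by (intro mult_nonneg_nonneg) auto
    moreover have "norm (y (u + s)) + T * norm l \<le> R" using that u by (intro R) auto
    ultimately show ?thesis by linarith
  qed
  have "excess (Y h) (X h) \<le> exp ((K * (1 + CARD('d)) + 1) * h) *
      (excess (Y 0) (X 0) + CARD('d) * (K * (h * norm l))\<^sup>2 * h)"
  proof (rule quasimonotone_comparison[where R = R and a = 0 and f = "branching_mechanism c B \<mu>"
        and Y' = "\<lambda>s. - branching_mechanism c B \<mu> (y (u + s))"
        and X' = "\<lambda>s. 0 - branching_mechanism c B \<mu> (X s)"])
    fix t assume t: "t \<in> {0..h}"
    have "((\<lambda>s. y (u + s)) has_vector_derivative (l - branching_mechanism c B \<mu> (y (u + t))))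
        (at t within {0..h})"
      by (rule has_vector_derivative_within_subset[OF branching_odeD(3)[OF branching_ode_shift[OF y u(1)]]])
        (use t in auto)
    moreover have "((\<lambda>s. (h - s) *\<^sub>R l) has_vector_derivative - l) (at t within {0..h})"
      by (auto intro!: derivative_eq_intros)
    ultimately show "(Y has_vector_derivative - branching_mechanism c B \<mu> (y (u + t))) (at t within {0..h})"
      unfolding Y_def using has_vector_derivative_add by fastforce
    show "(X has_vector_derivative 0 - branching_mechanism c B \<mu> (X t)) (at t within {0..h})"
      by (rule has_vector_derivative_within_subset[OF branching_odeD(3)[OF X]]) (use t in auto)
    fix i
    have "\<bar>branching_mechanism c B \<mu> (Y t) $ i - branching_mechanism c B \<mu> (y (u + t)) $ i\<bar>
        \<le> K * norm (Y t - y (u + t))"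
      using branching_odeD(2)[OF y, of "u + t"] t u by (intro lip Y0 nY ny) auto
    also have "\<dots> \<le> K * (h * norm l)"
      using small[OF t] K by (intro mult_left_mono) (auto simp: Y_def)
    finally show "(- branching_mechanism c B \<mu> (y (u + t))) $ i \<le>
        0 $ i - branching_mechanism c B \<mu> (Y t) $ i + K * (h * norm l)" by (simp add: abs_le_iff)
  qed (use Y0 nY branching_odeD(2)[OF X] lip K h in \<open>auto intro: branching_mechanism_quasimonotone[OF adm]\<close>)
  then show ?thesis by (simp add: Y_def branching_odeD(1)[OF X] excess_def)
qed

text \<open>
  Each step contributes an error of order \<open>h\<^sup>3\<close> to the excess, which is a squared distance, hence \<open>n = T/h\<close> steps contribute \<open>O(h\<^sup>2)\<close>. Only
  the one-sided statement is proved: it is the direction needed for upper bounds of Laplace transforms, and it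
  requires no bound on the scheme.
\<close>

lemma splitting_lower_bound:
  fixes y :: "real \<Rightarrow> real ^ 'd::finite" and T :: real
  assumes adm: "admissible c \<beta> B \<nu> \<mu>" and l: "0 \<le> l"
    and y: "branching_ode c B \<mu> l 0 y"
    and V: "\<And>m. 0 \<le> m \<Longrightarrow> branching_ode c B \<mu> 0 m (\<lambda>t. V t m)" and T: "0 \<le> T"
  defines "w \<equiv> \<lambda>n k. ((\<lambda>m. V (T / real n) (m + (T / real n) *\<^sub>R l)) ^^ k) 0"
  shows "(\<lambda>n. excess (y T) (w n n)) \<longlonglongrightarrow> 0"
proof -
  obtain R0 where R0: "\<And>t. t \<in> {0..T} \<Longrightarrow> norm (y t) \<le> R0"
    using branching_ode_bounded[OF y] by blast
  define R where "R = R0 + T * norm l"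
  have R: "\<And>t. t \<in> {0..T} \<Longrightarrow> norm (y t) + T * norm l \<le> R" using R0 by (simp add: R_def)
  obtain K where K: "0 \<le> K"
    "\<And>l m i. 0 \<le> l \<Longrightarrow> 0 \<le> m \<Longrightarrow> norm l \<le> R \<Longrightarrow> norm m \<le> R \<Longrightarrow>
       \<bar>branching_mechanism c B \<mu> l $ i - branching_mechanism c B \<mu> m $ i\<bar> \<le> K * norm (l - m)"
    using branching_mechanism_lipschitz[OF adm] by blast
  define L where "L = K * (1 + CARD('d)) + 1"
  have L: "0 \<le> L" using K by (simp add: L_def)
  have w0: "0 \<le> w n k" for n k
  proof (induction k)
    case (Suc k)
    have h: "0 \<le> T / real n" using T by simp
    then have "0 \<le> w n k + (T / real n) *\<^sub>R l"
      using Suc l by (intro add_nonneg_nonneg scaleR_nonneg_nonneg) auto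
    then show ?case using branching_odeD(2)[OF V h] by (simp add: w_def)
  qed (simp add: w_def)
  have bound: "excess (y (k * (T / n))) (w n k) \<le>
      exp (L * (k * (T / n))) * (CARD('d) * (K * (T / n * norm l))\<^sup>2 * (k * (T / n)))"
    if "k \<le> n" "0 < n" for n k :: nat
    using that
  proof (induction k)
    case 0
    show ?case using branching_odeD(1)[OF y] by (simp add: w_def excess_eq_0)
  next
    case (Suc k)
    let ?h = "T / real n" and ?e = "CARD('d) * (K * (T / n * norm l))\<^sup>2"
    have h: "0 \<le> ?h" using T by simp
    have IH: "excess (y (k * ?h)) (w n k) \<le> exp (L * (k * ?h)) * (?e * (k * ?h))"
      by (rule Suc.IH) (use Suc.prems in auto)
    have nh: "real n * ?h = T" using Suc.prems by simp
    have "1 * ?h \<le> real n * ?h" using Suc.prems h by (intro mult_right_mono) auto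
    then have hT: "?h \<le> T" by (simp only: nh mult_1_left)
    have factor: "p * (q * (e * x) + q * (e * z)) = (p * q) * (e * (x + z))" for p q e x z :: real
      by (simp add: algebra_simps)
    have uh: "real k * ?h + ?h = Suc k * ?h" by (simp only: of_nat_Suc distrib_right mult_1_left add.commute)
    have "Suc k * ?h \<le> n * ?h" using Suc.prems h by (intro mult_right_mono) auto
    then have uT: "real k * ?h + ?h \<le> T" using nh uh by linarith
    have wS: "w n (Suc k) = V ?h (w n k + ?h *\<^sub>R l)" by (simp add: w_def)
    have "excess (y (real k * ?h + ?h)) (V ?h (w n k + ?h *\<^sub>R l)) \<le>
        exp (L * ?h) * (excess (y (k * ?h)) (w n k) + ?e * ?h)"
      unfolding L_def
    proof (rule splitting_step[OF adm l y V h hT _ uT R K])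
      show "0 \<le> w n k + ?h *\<^sub>R l"
        using w0 h l by (intro add_nonneg_nonneg scaleR_nonneg_nonneg)
      show "0 \<le> real k * ?h" using h by (intro mult_nonneg_nonneg) auto
    qed
    also have "\<dots> \<le> exp (L * ?h) * (exp (L * (k * ?h)) * (?e * (k * ?h)) + ?e * ?h)"
      by (intro mult_left_mono add_right_mono IH exp_ge_zero)
    also have "\<dots> \<le> exp (L * ?h) * (exp (L * (k * ?h)) * (?e * (k * ?h)) + exp (L * (k * ?h)) * (?e * ?h))"
    proof (intro mult_left_mono add_left_mono)
      have "0 \<le> L * (k * ?h)" using L h by (intro mult_nonneg_nonneg) auto
      then have "1 \<le> exp (L * (k * ?h))" by (subst one_le_exp_iff)
      moreover have "0 \<le> ?e * ?h" using h by (intro mult_nonneg_nonneg) auto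
      ultimately have "1 * (?e * ?h) \<le> exp (L * (k * ?h)) * (?e * ?h)" by (rule mult_right_mono)
      then show "?e * ?h \<le> exp (L * (k * ?h)) * (?e * ?h)" by (simp only: mult_1_left)
    qed simp
    also have "\<dots> = (exp (L * ?h) * exp (L * (k * ?h))) * (?e * (k * ?h + ?h))"
      by (rule factor)
    also have "exp (L * ?h) * exp (L * (k * ?h)) = exp (L * (k * ?h + ?h))"
      by (simp only: distrib_left exp_add mult.commute[of "exp (L * ?h)"])
    finally show ?case unfolding uh wS .
  qed
  let ?b = "\<lambda>n. exp (L * T) * (CARD('d) * (K * (T / real n * norm l))\<^sup>2 * T)"
  have "\<forall>\<^sub>F n in sequentially. norm (excess (y T) (w n n)) \<le> ?b n"
    using eventually_gt_at_top[of "0::nat"]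
  proof eventually_elim
    case (elim n)
    then have "real n * (T / real n) = T" by simp
    then have "excess (y T) (w n n) \<le> ?b n" using bound[OF order_refl elim] by (simp only:)
    then show ?case using excess_nonneg[of "y T" "w n n"] by (simp only: real_norm_def abs_of_nonneg)
  qed
  moreover have "?b \<longlonglongrightarrow> exp (L * T) * (CARD('d) * (K * (0 * norm l))\<^sup>2 * T)"
    by (intro tendsto_intros lim_const_over_n)
  then have "?b \<longlonglongrightarrow> 0" by simp
  ultimately show ?thesis by (rule Lim_null_comparison)
qed

section \<open>Riemann sums of right-continuous paths\<close>

text \<open>
  One-sided limits give local boundedness at every point; compactness makes it global.
\<close>

lemma cadlag_bounded:
  fixes f :: "real \<Rightarrow> real"
  assumes f: "cadlag f"
  obtains C where "\<And>u. u \<in> {0..T} \<Longrightarrow> \<bar>f u\<bar> \<le> C"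
proof -
  have "\<exists>e>0. bounded (f ` ({0..T} \<inter> ball x e))" if x: "x \<in> {0..T}" for x
  proof -
    have "\<forall>\<^sub>F y in at_right x. dist (f y) (f x) < 1"
      using f x by (intro tendstoD) (auto simp: cadlag_def)
    then obtain b where b: "x < b" "\<And>y. x < y \<Longrightarrow> y < b \<Longrightarrow> dist (f y) (f x) < 1"
      unfolding eventually_at_right_field by blast
    obtain a z where a: "a < x" "\<And>y. 0 \<le> y \<Longrightarrow> a < y \<Longrightarrow> y < x \<Longrightarrow> dist (f y) z < 1"
    proof (cases "x = 0")
      case True
      show ?thesis by (rule that[of "-1"]) (use True in auto)
    next
      case False
      then have "0 < x" using x by simp
      with f have "\<exists>z. (f \<longlongrightarrow> z) (at_left x)" unfolding cadlag_def by simp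
      then obtain z where "(f \<longlongrightarrow> z) (at_left x)" ..
      then have "\<forall>\<^sub>F y in at_left x. dist (f y) z < 1" by (rule tendstoD) simp
      then obtain a where "a < x" "\<forall>y>a. y < x \<longrightarrow> dist (f y) z < 1"
        unfolding eventually_at_left_field by blast
      then show ?thesis by (intro that[of a z]) auto
    qed
    define e where "e = min (b - x) (x - a)"
    have "f ` ({0..T} \<inter> ball x e) \<subseteq> ball z 1 \<union> (ball (f x) 1 \<union> {f x})"
    proof
      fix v assume "v \<in> f ` ({0..T} \<inter> ball x e)"
      then obtain y where y: "v = f y" "0 \<le> y" "\<bar>x - y\<bar> < e" by (auto simp: dist_real_def)
      have "y < b" "a < y" using y(3) by (auto simp: e_def)
      then show "v \<in> ball z 1 \<union> (ball (f x) 1 \<union> {f x})"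
        using a(2)[of y] b(2)[of y] y by (cases y x rule: linorder_cases) (auto simp: dist_commute)
    qed
    then have "bounded (f ` ({0..T} \<inter> ball x e))"
      by (rule bounded_subset[rotated]) auto
    moreover have "0 < e" using a b by (simp add: e_def)
    ultimately show ?thesis by blast
  qed
  then obtain e where e: "\<And>x. x \<in> {0..T} \<Longrightarrow> 0 < e x \<and> bounded (f ` ({0..T} \<inter> ball x (e x)))" by metis
  have "{0..T} \<subseteq> (\<Union>x\<in>{0..T}. ball x (e x))"
  proof
    fix x assume "x \<in> {0..T}"
    with e[OF this] show "x \<in> (\<Union>x\<in>{0..T}. ball x (e x))" by (intro UN_I[of x]) auto
  qed
  then obtain D where D: "D \<subseteq> {0..T}" "finite D" "{0..T} \<subseteq> (\<Union>x\<in>D. ball x (e x))"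
    using compactE_image[of "{0..T}" "{0..T}" "\<lambda>x. ball x (e x)"] by (metis compact_Icc open_ball)
  then have "f ` {0..T} \<subseteq> (\<Union>x\<in>D. f ` ({0..T} \<inter> ball x (e x)))" by blast
  moreover have "bounded (\<Union>x\<in>D. f ` ({0..T} \<inter> ball x (e x)))" using D(1) e by (intro bounded_UN D(2) ballI) blast
  ultimately have "bounded (f ` {0..T})" using bounded_subset by blast
  then obtain C where "\<forall>x\<in>f ` {0..T}. norm x \<le> C" unfolding bounded_iff ..
  then show ?thesis by (intro that[of C]) auto
qed

lemma cadlag_tendsto_from_right:
  fixes f :: "real \<Rightarrow> real"
  assumes f: "cadlag f" and u: "0 \<le> u" and r: "r \<longlonglongrightarrow> u" "\<And>n. u \<le> r n"
  shows "(\<lambda>n. f (r n)) \<longlonglongrightarrow> f u"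
proof (rule tendstoI)
  fix e :: real assume e: "0 < e"
  have "\<forall>\<^sub>F y in at_right u. dist (f y) (f u) < e"
    using f u e by (intro tendstoD) (auto simp: cadlag_def)
  then obtain b where b: "u < b" "\<And>y. u < y \<Longrightarrow> y < b \<Longrightarrow> dist (f y) (f u) < e"
    unfolding eventually_at_right_field by blast
  show "\<forall>\<^sub>F n in sequentially. dist (f (r n)) (f u) < e"
    using order_tendstoD(2)[OF r(1) b(1)]
  proof eventually_elim
    case (elim n)
    then show ?case using b(2)[of "r n"] r(2)[of n] e by (cases "r n = u") auto
  qed
qed

text \<open>
  The cell of the grid with mesh \<open>h\<close> that contains \<open>u\<close>, with cells open on the left and closed on the right, is the one
  whose right end point is \<open>\<lceil>u / h\<rceil> h\<close>.
\<close>

lemma grid_cell: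
  fixes u h :: real
  assumes h: "0 < h" and u: "0 < u"
  shows "1 \<le> nat \<lceil>u / h\<rceil>" "(real (nat \<lceil>u / h\<rceil>) - 1) * h < u" "u \<le> real (nat \<lceil>u / h\<rceil>) * h"
    "(real k - 1) * h < u \<and> u \<le> real k * h \<longleftrightarrow> k = nat \<lceil>u / h\<rceil>"
proof -
  have pos: "0 < \<lceil>u / h\<rceil>" using h u by simp
  then show "1 \<le> nat \<lceil>u / h\<rceil>" by linarith
  have r: "real (nat \<lceil>u / h\<rceil>) = of_int \<lceil>u / h\<rceil>" using pos by simp
  have c: "of_int \<lceil>u / h\<rceil> - 1 < u / h" "u / h \<le> of_int \<lceil>u / h\<rceil>"
    using ceiling_correct[of "u / h"] by auto
  from c[unfolded pos_divide_le_eq[OF h] pos_less_divide_eq[OF h]]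
  show 1: "(real (nat \<lceil>u / h\<rceil>) - 1) * h < u" and 2: "u \<le> real (nat \<lceil>u / h\<rceil>) * h"
    unfolding r by auto
  show "(real k - 1) * h < u \<and> u \<le> real k * h \<longleftrightarrow> k = nat \<lceil>u / h\<rceil>"
  proof
    assume "(real k - 1) * h < u \<and> u \<le> real k * h"
    then have "of_int (int k) - 1 < u / h" "u / h \<le> of_int (int k)"
      unfolding pos_divide_le_eq[OF h] pos_less_divide_eq[OF h] by auto
    then have "\<lceil>u / h\<rceil> = int k" by (rule ceiling_unique)
    then show "k = nat \<lceil>u / h\<rceil>" by simp
  qed (use 1 2 in auto)
qed

text \<open>
  The Riemann sum with right end points is the integral of the step function taking on each cell the value of \<open>f\<close> at
  its right end point. These end points approach \<open>u\<close> from the right, so right-continuity gives pointwise convergence,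
  and dominated convergence applies since \<open>f\<close> is bounded. Measurability of \<open>f\<close> comes from the same limit.
\<close>

lemma cadlag_riemann_sums:
  fixes f :: "real \<Rightarrow> real"
  assumes f: "cadlag f" and T: "0 \<le> T"
  shows "set_integrable lborel {0<..T} f"
    and "(\<lambda>n. \<Sum>k = 1..n. (T / real n) * f (real k * (T / real n))) \<longlonglongrightarrow> (LBINT u:{0<..T}. f u)"
proof -
  let ?h = "\<lambda>n. T / real n"
  define s where "s n u = (\<Sum>k = 1..n. f (real k * ?h n) * indicator {(real k - 1) * ?h n<..real k * ?h n} u)"
    for n u
  define \<kappa> where "\<kappa> n u = nat \<lceil>u / ?h n\<rceil>" for n :: nat and u
  obtain C where C: "\<And>u. u \<in> {0..T} \<Longrightarrow> \<bar>f u\<bar> \<le> C" using cadlag_bounded[OF f] by blast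
  have s_in: "s n u = f (real (\<kappa> n u) * ?h n) \<and> u \<le> real (\<kappa> n u) * ?h n
      \<and> real (\<kappa> n u) * ?h n < u + ?h n \<and> real (\<kappa> n u) * ?h n \<le> T"
    if u: "u \<in> {0<..T}" and n: "0 < n" for n u
  proof -
    have h: "0 < ?h n" using u n by simp
    have u0: "0 < u" using u by simp
    note grid = grid_cell[OF h u0, folded \<kappa>_def]
    have nh: "real n * ?h n = T" using n by simp
    have "(real (\<kappa> n u) - 1) * ?h n < real n * ?h n" using grid(2) u unfolding nh greaterThanAtMost_iff by linarith
    then have "real (\<kappa> n u) - 1 < real n" using h by (simp only: mult_less_cancel_right_pos)
    then have \<kappa>: "\<kappa> n u \<le> n" by simp
    have "s n u = (\<Sum>k = 1..n. if k = \<kappa> n u then f (real k * ?h n) else 0)"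
      unfolding s_def
    proof (rule sum.cong)
      fix k
      show "f (real k * ?h n) * indicator {(real k - 1) * ?h n<..real k * ?h n} u =
          (if k = \<kappa> n u then f (real k * ?h n) else 0)"
        using grid(4)[of k] by (simp only: indicator_def greaterThanAtMost_iff) simp
    qed simp
    also have "\<dots> = f (real (\<kappa> n u) * ?h n)" using \<kappa> grid(1) by simp
    finally have "s n u = f (real (\<kappa> n u) * ?h n)" .
    moreover have "real (\<kappa> n u) * ?h n \<le> real n * ?h n" using \<kappa> h by (intro mult_right_mono) auto
    moreover have "real (\<kappa> n u) * ?h n < u + ?h n" using grid(2) unfolding left_diff_distrib by linarith
    ultimately show ?thesis using grid(3) nh by metis
  qed
  have s_out: "s n u = 0" if u: "u \<notin> {0<..T}" for n u
    unfolding s_def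
  proof (rule sum.neutral, rule ballI)
    fix k assume k: "k \<in> {1..n}"
    have h: "0 \<le> ?h n" using T by simp
    have "0 \<le> (real k - 1) * ?h n" using k h by (intro mult_nonneg_nonneg) auto
    moreover have "real k * ?h n \<le> real n * ?h n" using k h by (intro mult_right_mono) auto
    moreover have "real n * ?h n = T" using k by simp
    ultimately have "u \<notin> {(real k - 1) * ?h n<..real k * ?h n}" using u by auto
    then show "f (real k * ?h n) * indicator {(real k - 1) * ?h n<..real k * ?h n} u = 0" by simp
  qed
  have lim: "(\<lambda>n. s n u) \<longlonglongrightarrow> indicator {0<..T} u * f u" for u
  proof (cases "u \<in> {0<..T}")
    case True
    have "(\<lambda>n. real (\<kappa> n u) * ?h n) \<longlonglongrightarrow> u"
    proof (rule tendsto_sandwich)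
      show "\<forall>\<^sub>F n in sequentially. u \<le> real (\<kappa> n u) * ?h n"
        using eventually_gt_at_top[of "0::nat"] by eventually_elim (drule s_in[OF True], elim conjE)
      show "\<forall>\<^sub>F n in sequentially. real (\<kappa> n u) * ?h n \<le> u + ?h n"
        using eventually_gt_at_top[of "0::nat"] by eventually_elim (drule s_in[OF True], elim conjE, rule less_imp_le)
      show "(\<lambda>n. u + ?h n) \<longlonglongrightarrow> u"
        using tendsto_add[OF tendsto_const lim_const_over_n[of T], of u] by simp
    qed simp
    \<comment> \<open>The maximum with \<open>u\<close> only affects \<open>n = 0\<close>, where the grid point is 0.\<close>
    then have "(\<lambda>n. max u (real (\<kappa> n u) * ?h n)) \<longlonglongrightarrow> max u u" by (intro tendsto_intros)
    then have "(\<lambda>n. f (max u (real (\<kappa> n u) * ?h n))) \<longlonglongrightarrow> f u"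
      using True by (intro cadlag_tendsto_from_right[OF f]) auto
    moreover have "\<forall>\<^sub>F n in sequentially. f (max u (real (\<kappa> n u) * ?h n)) = s n u"
      using eventually_gt_at_top[of "0::nat"]
      by eventually_elim (drule s_in[OF True], elim conjE, simp only: max_absorb2)
    ultimately have "(\<lambda>n. s n u) \<longlonglongrightarrow> f u" by (rule Lim_transform_eventually)
    then show ?thesis using True by simp
  qed (simp add: s_out)
  have cell: "(real k - 1) * ?h n \<le> real k * ?h n" for k n :: nat
    using T by (intro mult_right_mono) auto
  have cell_int: "integrable lborel (\<lambda>u. f (real k * ?h n) * indicator {(real k - 1) * ?h n<..real k * ?h n} u)"
    for k n :: nat
    by (intro integrable_mult_right integrable_real_indicator)
      (simp_all only: emeasure_lborel_Ioc[OF cell] ennreal_less_top sets_lborel greaterThanAtMost_borel infinity_ennreal_def)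
  have s_int: "integrable lborel (s n)" for n
    unfolding s_def by (intro Bochner_Integration.integrable_sum cell_int)
  have meas: "(\<lambda>u. indicator {0<..T} u * f u) \<in> borel_measurable lborel"
    by (rule borel_measurable_LIMSEQ_real[OF lim]) (use s_int in auto)
  have dom: "norm (s n u) \<le> C * indicator {0<..T} u" if "0 < n" for n u
  proof (cases "u \<in> {0<..T}")
    case True
    then have "0 \<le> real (\<kappa> n u) * ?h n" using T by (intro mult_nonneg_nonneg) auto
    with s_in[OF True that] have "\<bar>f (real (\<kappa> n u) * ?h n)\<bar> \<le> C" by (intro C) (simp only: atLeastAtMost_iff)
    then show ?thesis using s_in[OF True that] True by (simp only: real_norm_def indicator_simps mult_1_right)
  qed (simp add: s_out)
  have dom_int: "integrable lborel (\<lambda>u. C * indicator {0<..T} u)"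
    using T by (intro integrable_mult_right integrable_real_indicator) auto
  \<comment> \<open>The shift avoids the index \<open>n = 0\<close>, where the mesh \<open>T / 0\<close> has the default value 0.\<close>
  have lim': "(\<lambda>n. s (Suc n) u) \<longlonglongrightarrow> indicator {0<..T} u * f u" for u
    by (rule LIMSEQ_Suc[OF lim])
  have "integrable lborel (\<lambda>u. indicator {0<..T} u * f u)"
    by (rule integrable_dominated_convergence[OF meas _ dom_int, of "\<lambda>n. s (Suc n)"])
      (use s_int lim' dom in auto)
  then show "set_integrable lborel {0<..T} f" by (simp add: set_integrable_def)
  have "(\<lambda>n. integral\<^sup>L lborel (s (Suc n))) \<longlonglongrightarrow> (\<integral>u. indicator {0<..T} u * f u \<partial>lborel)"
    by (rule integral_dominated_convergence[OF meas _ dom_int, of "\<lambda>n. s (Suc n)"])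
      (use s_int lim' dom in auto)
  then have "(\<lambda>n. integral\<^sup>L lborel (s n)) \<longlonglongrightarrow> (\<integral>u. indicator {0<..T} u * f u \<partial>lborel)"
    by (rule LIMSEQ_imp_Suc)
  moreover have "integral\<^sup>L lborel (s n) = (\<Sum>k = 1..n. ?h n * f (real k * ?h n))" for n
  proof -
    have "integral\<^sup>L lborel (s n) = (\<Sum>k = 1..n. \<integral>u. f (real k * ?h n) *
        indicator {(real k - 1) * ?h n<..real k * ?h n} u \<partial>lborel)"
      unfolding s_def
      by (intro Bochner_Integration.integral_sum cell_int)
    also have "\<dots> = (\<Sum>k = 1..n. ?h n * f (real k * ?h n))"
    proof (rule sum.cong)
      fix k assume "k \<in> {1..n}"
      have "measure lborel {(real k - 1) * ?h n<..real k * ?h n} = ?h n"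
        unfolding measure_lborel_Ioc[OF cell] by (simp only: left_diff_distrib)
      then show "(\<integral>u. f (real k * ?h n) * indicator {(real k - 1) * ?h n<..real k * ?h n} u \<partial>lborel)
          = ?h n * f (real k * ?h n)" by simp
    qed simp
    finally show ?thesis .
  qed
  ultimately show "(\<lambda>n. \<Sum>k = 1..n. ?h n * f (real k * ?h n)) \<longlonglongrightarrow> (LBINT u:{0<..T}. f u)"
    by (simp add: set_lebesgue_integral_def)
qed

text \<open>
  Expresses the total integral through integrals over compact intervals, which are limits of Riemann sums; this is how
  the total integral of a process becomes measurable in the sample point.
\<close>

lemma cadlag_nn_integral_eq_SUP:
  fixes f :: "real \<Rightarrow> real"
  assumes f: "cadlag f" and f0: "\<And>u. 0 \<le> u \<Longrightarrow> 0 \<le> f u"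
  shows "(\<integral>\<^sup>+u\<in>{0..}. ennreal (f u) \<partial>lborel) = (SUP N::nat. ennreal (LBINT u:{0<..real N}. f u))"
proof -
  have int: "integrable lborel (\<lambda>u. indicator {0<..real N} u * f u)" for N :: nat
    using cadlag_riemann_sums(1)[OF f, of "real N"] by (simp add: set_integrable_def)
  let ?g = "\<lambda>(N::nat) u. ennreal (indicator {0<..real N} u * f u)"
  have g0: "0 \<le> indicator {0<..real N} u * f u" for N :: nat and u
    using f0 by (simp add: indicator_def)
  have sup: "(SUP N. ?g N u) = ennreal (f u) * indicator {0..} u" if "u \<noteq> 0" for u
  proof (cases "0 < u")
    case True
    obtain N :: nat where N: "u \<le> real N" using real_arch_simple by blast
    have "(SUP N. ?g N u) = ennreal (f u)"
    proof (rule antisym)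
      show "(SUP N. ?g N u) \<le> ennreal (f u)"
        using True f0[of u] by (intro SUP_least ennreal_leI) (auto simp: indicator_def)
      have "ennreal (f u) = ?g N u" using True N by simp
      also have "\<dots> \<le> (SUP N. ?g N u)" by (rule SUP_upper) simp
      finally show "ennreal (f u) \<le> (SUP N. ?g N u)" .
    qed
    then show ?thesis using True by simp
  qed (use that in auto)
  have "(\<integral>\<^sup>+u\<in>{0..}. ennreal (f u) \<partial>lborel) = (\<integral>\<^sup>+u. (SUP N. ?g N u) \<partial>lborel)"
  proof (rule nn_integral_cong_AE)
    show "AE u in lborel. ennreal (f u) * indicator {0..} u = (SUP N. ?g N u)"
      using AE_lborel_singleton[of "0::real"] by eventually_elim (simp add: sup)
  qed
  also have "\<dots> = (SUP N. \<integral>\<^sup>+u. ?g N u \<partial>lborel)"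
  proof (rule nn_integral_monotone_convergence_SUP)
    show "incseq ?g"
      using f0 by (intro monoI le_funI ennreal_leI) (auto simp: indicator_def)
    show "?g N \<in> borel_measurable lborel" for N
      using borel_measurable_integrable[OF int[of N]] by simp
  qed
  also have "(\<lambda>N. \<integral>\<^sup>+u. ?g N u \<partial>lborel) = (\<lambda>N. ennreal (LBINT u:{0<..real N}. f u))"
    using nn_integral_eq_integral[OF int] g0 by (simp add: set_lebesgue_integral_def)
  finally show ?thesis .
qed

section \<open>The Markov property and Laplace transforms of Riemann sums\<close>

lemma subalgebra_past_sigma:
  assumes Z: "\<And>u. 0 \<le> u \<Longrightarrow> Z u \<in> measurable M orthant_borel"
  shows "subalgebra M (past_sigma M Z s)"
    and "\<And>u. 0 \<le> u \<Longrightarrow> u \<le> s \<Longrightarrow> Z u \<in> measurable (past_sigma M Z s) orthant_borel"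
proof -
  let ?G = "\<Union>u\<in>{0..s}. {Z u -` A \<inter> space M | A. A \<in> sets orthant_borel}"
  have G: "?G \<subseteq> Pow (space M)" by auto
  have sets: "sets (past_sigma M Z s) = sigma_sets (space M) ?G"
    unfolding past_sigma_def by (rule sets_measure_of[OF G])
  have space: "space (past_sigma M Z s) = space M"
    unfolding past_sigma_def by (rule space_measure_of[OF G])
  have "?G \<subseteq> sets M" using Z by (auto intro: measurable_sets)
  then have "sigma_sets (space M) ?G \<subseteq> sets M" by (rule sets.sigma_sets_subset)
  then show "subalgebra M (past_sigma M Z s)" by (simp add: subalgebra_def sets space)
  fix u assume u: "0 \<le> u" "u \<le> s"
  show "Z u \<in> measurable (past_sigma M Z s) orthant_borel"
  proof (rule measurableI)
    show "Z u w \<in> space orthant_borel" if "w \<in> space (past_sigma M Z s)" for w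
      using measurable_space[OF Z[OF u(1)]] that by (simp only: space)
    show "Z u -` A \<inter> space (past_sigma M Z s) \<in> sets (past_sigma M Z s)" if "A \<in> sets orthant_borel" for A
      unfolding sets space using that u by (intro sigma_sets.Basic UN_I[of u]) auto
  qed
qed

text \<open>
  The Markov property is given for indicators of sets at time \<open>s + t\<close>. With \<open>X\<close> as a density it says that the law of
  \<open>Z\<^sub>s\<^sub>+\<^sub>t\<close> is the law of \<open>Z\<^sub>s\<close> composed with the kernel \<open>P\<^sub>t\<close>, and an identity of measures passes to all nonnegative
  integrands at once.
\<close>

lemma markov_process_nn_integral:
  fixes Z :: "real \<Rightarrow> 'w \<Rightarrow> real ^ 'd::finite"
  assumes M: "prob_space M" and P: "transition_semigroup P" and Z: "markov_process P M Z"
    and s: "0 \<le> s" and t: "0 \<le> t"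
    and X: "X \<in> borel_measurable (past_sigma M Z s)" "\<And>w. 0 \<le> X w" "\<And>w. X w \<le> (1::real)"
    and f: "f \<in> borel_measurable orthant_borel"
  shows "(\<integral>\<^sup>+w. ennreal (X w) * f (Z (s + t) w) \<partial>M)
    = (\<integral>\<^sup>+w. ennreal (X w) * (\<integral>\<^sup>+y. f y \<partial>P t (Z s w)) \<partial>M)"
proof -
  interpret prob_space M by fact
  let ?N = "orthant_borel :: (real ^ 'd) measure"
  let ?F = "past_sigma M Z s"
  have Zm: "Z u \<in> measurable M ?N" if "0 \<le> u" for u
    using Z that by (simp add: markov_process_def)
  have sub: "subalgebra M ?F" by (rule subalgebra_past_sigma(1)[OF Zm])
  interpret finite_measure_subalgebra M ?F by unfold_locales (rule sub)
  have Pm: "P t \<in> measurable ?N (prob_algebra ?N)" using P t by (simp add: transition_semigroup_def)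
  then have Psub: "P t \<in> measurable ?N (subprob_algebra ?N)" by (rule measurable_prob_algebraD)
  have XM[measurable]: "X \<in> borel_measurable M" using measurable_from_subalg[OF sub X(1)] .
  have Zs[measurable]: "Z s \<in> measurable M ?N" and Zst[measurable]: "Z (s + t) \<in> measurable M ?N"
    using Zm s t by auto
  have prob: "prob_space (P t (Z s w))" "sets (P t (Z s w)) = sets ?N" if "w \<in> space M" for w
    using measurable_space[OF Pm measurable_space[OF Zs that]] by (auto simp: space_prob_algebra)
  let ?D = "density M (\<lambda>w. ennreal (X w))"
  have Zsd: "Z s \<in> measurable ?D ?N" and Zstd: "Z (s + t) \<in> measurable ?D ?N" by simp_all
  have Psubd: "P t \<in> measurable (distr ?D ?N (Z s)) (subprob_algebra ?N)" using Psub by simp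
  have ne: "space (distr ?D ?N (Z s)) \<noteq> {}" by (simp add: space_restrict_space)
  have "distr ?D ?N (Z (s + t)) = distr ?D ?N (Z s) \<bind> P t"
  proof (rule measure_eqI)
    show "sets (distr ?D ?N (Z (s + t))) = sets (distr ?D ?N (Z s) \<bind> P t)"
      using sets_bind[OF _ ne, of "P t" ?N] measurable_space[OF Psub] by (simp add: space_subprob_algebra)
    fix A assume "A \<in> sets (distr ?D ?N (Z (s + t)))"
    then have A[measurable]: "A \<in> sets ?N" by simp
    have ind[measurable]: "(\<lambda>w. indicator A (Z (s + t) w) :: real) \<in> borel_measurable M" by simp
    have PA[measurable]: "(\<lambda>w. measure (P t (Z s w)) A) \<in> borel_measurable M"
      using measurable_compose[OF measurable_compose[OF Zs Pm] measurable_measure_prob_algebra[OF A]] .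
    have PA1: "measure (P t (Z s w)) A \<le> 1" if "w \<in> space M" for w
      using prob_space.prob_le_1[OF prob(1)[OF that]] .
    have le1: "x * y \<le> (1::real)" if "0 \<le> x" "x \<le> 1" "0 \<le> y" "y \<le> 1" for x y
      using mult_mono[of x 1 y 1] that by simp
    have int1: "integrable M (\<lambda>w. X w * indicator A (Z (s + t) w))"
      by (rule integrable_const_bound[of _ 1]) (use X le1 in \<open>auto simp: indicator_def\<close>)
    have int2: "integrable M (\<lambda>w. X w * measure (P t (Z s w)) A)"
      by (rule integrable_const_bound[of _ 1], rule AE_I2) (use X le1 PA1 in auto)
    have "(\<integral>w. X w * indicator A (Z (s + t) w) \<partial>M)
        = (\<integral>w. X w * real_cond_exp M ?F (\<lambda>w. indicator A (Z (s + t) w)) w \<partial>M)"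
      by (rule real_cond_exp_intg(2)[OF int1 X(1) ind, symmetric])
    also have "\<dots> = (\<integral>w. X w * measure (P t (Z s w)) A \<partial>M)"
    proof (rule Bochner_Integration.integral_cong_AE)
      have "AE w in M. real_cond_exp M ?F (\<lambda>w. indicator A (Z (s + t) w)) w = measure (P t (Z s w)) A"
        using Z s t A unfolding markov_process_def by blast
      then show "AE w in M. X w * real_cond_exp M ?F (\<lambda>w. indicator A (Z (s + t) w)) w
          = X w * measure (P t (Z s w)) A" by eventually_elim simp
    qed (use borel_measurable_cond_exp2 in measurable)
    finally have eq: "(\<integral>w. X w * indicator A (Z (s + t) w) \<partial>M) = (\<integral>w. X w * measure (P t (Z s w)) A \<partial>M)" .
    have "emeasure (distr ?D ?N (Z (s + t))) A = emeasure ?D (Z (s + t) -` A \<inter> space M)"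
      using Zstd A by (subst emeasure_distr) auto
    also have "\<dots> = (\<integral>\<^sup>+w. ennreal (X w * indicator A (Z (s + t) w)) \<partial>M)"
      by (subst emeasure_density) (auto simp: X(2) ennreal_mult indicator_def intro!: nn_integral_cong)
    also have "\<dots> = ennreal (\<integral>w. X w * indicator A (Z (s + t) w) \<partial>M)"
      by (rule nn_integral_eq_integral[OF int1]) (simp add: X(2))
    also have "\<dots> = (\<integral>\<^sup>+w. ennreal (X w * measure (P t (Z s w)) A) \<partial>M)"
      unfolding eq by (rule nn_integral_eq_integral[OF int2, symmetric]) (simp add: X(2))
    also have "\<dots> = (\<integral>\<^sup>+w. ennreal (X w) * emeasure (P t (Z s w)) A \<partial>M)"
    proof (rule nn_integral_cong)
      fix w assume w: "w \<in> space M"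
      interpret p: prob_space "P t (Z s w)" by (rule prob(1)[OF w])
      show "ennreal (X w * measure (P t (Z s w)) A) = ennreal (X w) * emeasure (P t (Z s w)) A"
        by (simp add: p.emeasure_eq_measure ennreal_mult X(2))
    qed
    also have "\<dots> = (\<integral>\<^sup>+w. emeasure (P t (Z s w)) A \<partial>?D)"
      using measurable_compose[OF measurable_compose[OF Zs Psub] measurable_emeasure_subprob_algebra[OF A]]
      by (subst nn_integral_density) auto
    also have "\<dots> = (\<integral>\<^sup>+z. emeasure (P t z) A \<partial>distr ?D ?N (Z s))"
      using measurable_compose[OF Psub measurable_emeasure_subprob_algebra[OF A]] Zsd
      by (subst nn_integral_distr) auto
    also have "\<dots> = emeasure (distr ?D ?N (Z s) \<bind> P t) A"
      by (rule emeasure_bind[OF ne Psubd A, symmetric])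
    finally show "emeasure (distr ?D ?N (Z (s + t))) A = emeasure (distr ?D ?N (Z s) \<bind> P t) A" .
  qed
  note law = this
  have fm: "(\<lambda>z. \<integral>\<^sup>+y. f y \<partial>P t z) \<in> borel_measurable ?N"
    by (rule measurable_compose[OF Psub nn_integral_measurable_subprob_algebra[OF f]])
  have "(\<integral>\<^sup>+w. ennreal (X w) * f (Z (s + t) w) \<partial>M) = (\<integral>\<^sup>+w. f (Z (s + t) w) \<partial>?D)"
    using measurable_compose[OF Zst f] by (subst nn_integral_density) auto
  also have "\<dots> = (\<integral>\<^sup>+y. f y \<partial>distr ?D ?N (Z (s + t)))"
    by (rule nn_integral_distr[OF Zstd, symmetric]) (use f in simp)
  also have "\<dots> = (\<integral>\<^sup>+z. \<integral>\<^sup>+y. f y \<partial>P t z \<partial>distr ?D ?N (Z s))"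
    unfolding law by (rule nn_integral_bind[OF f Psubd])
  also have "\<dots> = (\<integral>\<^sup>+w. \<integral>\<^sup>+y. f y \<partial>P t (Z s w) \<partial>?D)"
    by (rule nn_integral_distr[OF Zsd]) (use fm in simp)
  also have "\<dots> = (\<integral>\<^sup>+w. ennreal (X w) * (\<integral>\<^sup>+y. f y \<partial>P t (Z s w)) \<partial>M)"
    using measurable_compose[OF Zs fm] by (subst nn_integral_density) auto
  finally show ?thesis .
qed

lemma borel_measurable_orthant:
  "f \<in> borel_measurable borel \<Longrightarrow> f \<in> borel_measurable orthant_borel"
  by (rule measurable_restrict_space1)

text \<open>
  Conditioning on the last but one grid time \<open>n h\<close> merges the last increment \<open>h l\<close> with the terminal parameter \<open>m\<close>
  and turns \<open>m + h l\<close> into \<open>V(h, m + h l)\<close>. Keeping \<open>m\<close> arbitrary is what makes the induction work.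
\<close>

lemma cb_laplace_riemann_sum:
  fixes Z :: "real \<Rightarrow> 'w \<Rightarrow> real ^ 'd::finite"
  assumes M: "prob_space M" and P: "transition_semigroup P" and Z: "markov_process P M Z"
    and V: "\<And>l. 0 \<le> l \<Longrightarrow> branching_ode c B \<mu> 0 l (\<lambda>t. V t l)"
    and PV: "\<And>t x l. 0 \<le> t \<Longrightarrow> 0 \<le> x \<Longrightarrow> 0 \<le> l \<Longrightarrow>
      (\<integral>y. exp (- (l \<bullet> y)) \<partial>P t x) = exp (- (x \<bullet> V t l))"
    and init: "AE w in M. Z 0 w = x" and x: "0 \<le> x"
    and h: "0 \<le> h" and l: "0 \<le> l" and m: "0 \<le> m"
  shows "(\<integral>\<^sup>+w. ennreal (exp (- (\<Sum>k = 1..n. h * (l \<bullet> Z (real k * h) w)) - m \<bullet> Z (real n * h) w)) \<partial>M)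
    = ennreal (exp (- (x \<bullet> ((\<lambda>m. V h (m + h *\<^sub>R l)) ^^ n) m)))"
  using m
proof (induction n arbitrary: m)
  case 0
  interpret prob_space M by fact
  have "(\<integral>\<^sup>+w. ennreal (exp (- (m \<bullet> Z 0 w))) \<partial>M) = (\<integral>\<^sup>+w. ennreal (exp (- (m \<bullet> x))) \<partial>M)"
    by (rule nn_integral_cong_AE) (use init in eventually_elim, simp)
  then show ?case by (simp add: emeasure_space_1 inner_commute)
next
  case (Suc n)
  let ?N = "orthant_borel :: (real ^ 'd) measure"
  have Zm: "Z u \<in> measurable M ?N" if "0 \<le> u" for u
    using Z that by (simp add: markov_process_def)
  have Z0: "0 \<le> Z u w" if "0 \<le> u" "w \<in> space M" for u w
    using measurable_space[OF Zm[OF that(1)] that(2)] by (simp add: space_restrict_space)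
  have nh: "0 \<le> real n * h" using h by simp
  let ?m = "m + h *\<^sub>R l"
  have m': "0 \<le> ?m" using Suc.prems h l by (intro add_nonneg_nonneg scaleR_nonneg_nonneg)
  \<comment> \<open>The truncation by \<open>max\<close> is inactive on the space of \<open>M\<close>; it makes \<open>X \<le> 1\<close> hold everywhere.\<close>
  define X where "X w = (\<Prod>k = 1..n. exp (- max 0 (h * (l \<bullet> Z (real k * h) w))))" for w
  have X: "0 \<le> X w" "X w \<le> 1" for w
    by (auto simp: X_def intro: prod_nonneg prod_le_1)
  have Xeq: "X w = exp (- (\<Sum>k = 1..n. h * (l \<bullet> Z (real k * h) w)))" if "w \<in> space M" for w
  proof -
    have "X w = (\<Prod>k = 1..n. exp (- (h * (l \<bullet> Z (real k * h) w))))"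
      unfolding X_def
    proof (rule prod.cong)
      fix k
      have "0 \<le> h * (l \<bullet> Z (real k * h) w)"
        using h l Z0[of "real k * h" w] that by (intro mult_nonneg_nonneg inner_nonneg_cart) auto
      then show "exp (- max 0 (h * (l \<bullet> Z (real k * h) w))) = exp (- (h * (l \<bullet> Z (real k * h) w)))"
        by (simp only: max_absorb2)
    qed simp
    then show ?thesis by (simp add: exp_sum[symmetric] sum_negf)
  qed
  have inner_m: "(\<lambda>y. a \<bullet> y) \<in> borel_measurable ?N" for a
    by (rule borel_measurable_orthant) simp
  have Xm: "X \<in> borel_measurable (past_sigma M Z (real n * h))"
    unfolding X_def
  proof (rule borel_measurable_prod)
    fix k assume k: "k \<in> {1..n}"
    have "real k * h \<le> real n * h" using k h by (intro mult_right_mono) auto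
    then have "Z (real k * h) \<in> measurable (past_sigma M Z (real n * h)) ?N"
      using h by (intro subalgebra_past_sigma(2)[OF Zm]) auto
    from measurable_compose[OF this inner_m[of l]]
    show "(\<lambda>w. exp (- max 0 (h * (l \<bullet> Z (real k * h) w)))) \<in> borel_measurable (past_sigma M Z (real n * h))"
      by simp
  qed
  let ?f = "\<lambda>y. ennreal (exp (- (?m \<bullet> y)))"
  have fm: "?f \<in> borel_measurable ?N" using inner_m[of ?m] by simp
  have uh: "real (Suc n) * h = real n * h + h" by (simp add: algebra_simps)
  have "(\<integral>\<^sup>+w. ennreal (exp (- (\<Sum>k = 1..Suc n. h * (l \<bullet> Z (real k * h) w)) - m \<bullet> Z (real (Suc n) * h) w)) \<partial>M)
      = (\<integral>\<^sup>+w. ennreal (X w) * ?f (Z (real n * h + h) w) \<partial>M)"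
  proof (rule nn_integral_cong)
    fix w assume w: "w \<in> space M"
    have "- (\<Sum>k = 1..Suc n. h * (l \<bullet> Z (real k * h) w)) - m \<bullet> Z (real (Suc n) * h) w
        = - (\<Sum>k = 1..n. h * (l \<bullet> Z (real k * h) w)) + - (?m \<bullet> Z (real n * h + h) w)"
      unfolding sum.cl_ivl_Suc uh by (simp add: inner_add_left algebra_simps)
    then show "ennreal (exp (- (\<Sum>k = 1..Suc n. h * (l \<bullet> Z (real k * h) w)) - m \<bullet> Z (real (Suc n) * h) w))
        = ennreal (X w) * ?f (Z (real n * h + h) w)"
      by (simp only: exp_add Xeq[OF w] ennreal_mult[OF exp_ge_zero exp_ge_zero])
  qed
  also have "\<dots> = (\<integral>\<^sup>+w. ennreal (X w) * (\<integral>\<^sup>+y. ?f y \<partial>P h (Z (real n * h) w)) \<partial>M)"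
    by (rule markov_process_nn_integral[OF M P Z nh h Xm X fm])
  also have "\<dots> = (\<integral>\<^sup>+w. ennreal (exp (- (\<Sum>k = 1..n. h * (l \<bullet> Z (real k * h) w))
      - V h ?m \<bullet> Z (real n * h) w)) \<partial>M)"
  proof (rule nn_integral_cong)
    fix w assume w: "w \<in> space M"
    let ?z = "Z (real n * h) w"
    have z: "0 \<le> ?z" by (rule Z0[OF nh w])
    have "P h ?z \<in> space (prob_algebra ?N)"
      using P h z by (intro measurable_space[of "P h" ?N]) (auto simp: transition_semigroup_def space_restrict_space)
    then have sets: "sets (P h ?z) = sets ?N" and "prob_space (P h ?z)" by (auto simp: space_prob_algebra)
    then interpret p: prob_space "P h ?z" by simp
    have sp: "space (P h ?z) = {0..}" using sets_eq_imp_space_eq[OF sets] by (simp add: space_restrict_space)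
    have "integrable (P h ?z) (\<lambda>y. exp (- (?m \<bullet> y)))"
    proof (rule p.integrable_const_bound[of _ 1])
      show "AE y in P h ?z. norm (exp (- (?m \<bullet> y))) \<le> 1"
        using inner_nonneg_cart[OF m'] by (intro AE_I2) (simp add: sp)
      have "(\<lambda>y. exp (- (?m \<bullet> y))) \<in> borel_measurable ?N" using inner_m[of ?m] by simp
      then show "(\<lambda>y. exp (- (?m \<bullet> y))) \<in> borel_measurable (P h ?z)"
        by (subst measurable_cong_sets[OF sets refl])
    qed
    then have "(\<integral>\<^sup>+y. ?f y \<partial>P h ?z) = ennreal (exp (- (?z \<bullet> V h ?m)))"
      by (subst nn_integral_eq_integral) (simp_all add: PV[OF h z m'])
    then show "ennreal (X w) * (\<integral>\<^sup>+y. ?f y \<partial>P h ?z) =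
        ennreal (exp (- (\<Sum>k = 1..n. h * (l \<bullet> Z (real k * h) w)) - V h ?m \<bullet> ?z))"
      by (simp only: Xeq[OF w] ennreal_mult[OF exp_ge_zero exp_ge_zero, symmetric] exp_add[symmetric]
          inner_commute[of ?z] diff_conv_add_uminus)
  qed
  also have "\<dots> = ennreal (exp (- (x \<bullet> ((\<lambda>m. V h (m + h *\<^sub>R l)) ^^ n) (V h ?m))))"
    by (rule Suc.IH) (use branching_odeD(2)[OF V[OF m'] h] in simp)
  finally show ?case by (simp only: funpow_Suc_right comp_def)
qed

section \<open>Total integrals of the CB process\<close>

lemma cadlag_component:
  fixes f :: "real \<Rightarrow> real ^ 'd::finite"
  assumes f: "cadlag f"
  shows "cadlag (\<lambda>t. f t $ j)"
  unfolding cadlag_def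
proof (intro conjI allI impI)
  fix t :: real assume "0 \<le> t"
  then have "(f \<longlongrightarrow> f t) (at_right t)" using f by (simp add: cadlag_def)
  then show "((\<lambda>t. f t $ j) \<longlongrightarrow> f t $ j) (at_right t)" by (rule tendsto_vec_nth)
next
  fix t :: real assume "0 < t"
  then have "\<exists>z. (f \<longlongrightarrow> z) (at_left t)" using f by (simp add: cadlag_def)
  then obtain z where "(f \<longlongrightarrow> z) (at_left t)" ..
  then have "((\<lambda>t. f t $ j) \<longlongrightarrow> z $ j) (at_left t)" by (rule tendsto_vec_nth)
  then show "\<exists>y. ((\<lambda>t. f t $ j) \<longlongrightarrow> y) (at_left t)" ..
qed

lemma cb_process_component:
  fixes Z :: "real \<Rightarrow> 'w \<Rightarrow> real ^ 'd::finite"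
  assumes cb: "cb_process c B \<mu> x M Z"
  shows "0 \<le> u \<Longrightarrow> (\<lambda>w. Z u w $ j) \<in> borel_measurable M"
    and "0 \<le> u \<Longrightarrow> w \<in> space M \<Longrightarrow> 0 \<le> Z u w $ j"
    and "w \<in> space M \<Longrightarrow> cadlag (\<lambda>u. Z u w $ j)"
proof -
  have Zm: "Z u \<in> measurable M orthant_borel" if "0 \<le> u" for u
    using cb that by (auto simp: cb_process_def markov_process_def)
  have "(\<lambda>y::real ^ 'd. y $ j) \<in> borel_measurable orthant_borel"
    by (intro measurable_restrict_space1 borel_measurable_continuous_onI continuous_intros)
  then show "0 \<le> u \<Longrightarrow> (\<lambda>w. Z u w $ j) \<in> borel_measurable M"
    using measurable_compose[OF Zm] by blast
  show "0 \<le> u \<Longrightarrow> w \<in> space M \<Longrightarrow> 0 \<le> Z u w $ j"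
    using measurable_space[OF Zm] by (auto simp: space_restrict_space less_eq_vec_def)
  show "w \<in> space M \<Longrightarrow> cadlag (\<lambda>u. Z u w $ j)"
    using cb by (intro cadlag_component) (simp add: cb_process_def)
qed

lemma borel_measurable_cb_integral:
  fixes Z :: "real \<Rightarrow> 'w \<Rightarrow> real ^ 'd::finite"
  assumes cb: "cb_process c B \<mu> x M Z" and T: "0 \<le> T"
  shows "(\<lambda>w. LBINT u:{0<..T}. Z u w $ j) \<in> borel_measurable M"
proof (rule borel_measurable_LIMSEQ_real)
  show "(\<lambda>n. \<Sum>k = 1..n. (T / real n) * Z (real k * (T / real n)) w $ j) \<longlonglongrightarrow> (LBINT u:{0<..T}. Z u w $ j)"
    if "w \<in> space M" for w
    by (rule cadlag_riemann_sums(2)[OF cb_process_component(3)[OF cb that] T])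
  show "(\<lambda>w. \<Sum>k = 1..n. (T / real n) * Z (real k * (T / real n)) w $ j) \<in> borel_measurable M" for n
    using T by (intro borel_measurable_sum borel_measurable_times borel_measurable_const cb_process_component(1)[OF cb])
      auto
qed

text \<open>
  Riemann sums converge path by path, which gives the bound by Fatou's lemma; the lower bound for the splitting scheme
  controls their Laplace transforms.
\<close>

lemma cb_integral_laplace_le:
  fixes Z :: "real \<Rightarrow> 'w \<Rightarrow> real ^ 'd::finite"
  assumes adm: "admissible c \<beta> B \<nu> \<mu>" and cb: "cb_process c B \<mu> x M Z"
    and x: "0 \<le> x" and l: "0 \<le> l" and y: "branching_ode c B \<mu> l 0 y" and T: "0 \<le> T"
  shows "(\<integral>\<^sup>+w. ennreal (exp (- (\<Sum>j\<in>UNIV. l $ j * (LBINT u:{0<..T}. Z u w $ j)))) \<partial>M)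
    \<le> ennreal (exp (- (x \<bullet> y T)))"
proof -
  have M: "prob_space M" and init: "AE w in M. Z 0 w = x" using cb by (auto simp: cb_process_def)
  obtain P where sg: "cb_semigroup c B \<mu> P" and mk: "markov_process P M Z"
    using cb by (auto simp: cb_process_def)
  obtain V where V: "\<And>l. 0 \<le> l \<Longrightarrow> branching_ode c B \<mu> 0 l (\<lambda>t. V t l)"
    and PV: "\<And>t x l. 0 \<le> t \<Longrightarrow> 0 \<le> x \<Longrightarrow> 0 \<le> l \<Longrightarrow>
      (\<integral>y. exp (- (l \<bullet> y)) \<partial>P t x) = exp (- (x \<bullet> V t l))"
    using sg unfolding cb_semigroup_def by blast
  have P: "transition_semigroup P" using sg by (simp add: cb_semigroup_def)
  let ?h = "\<lambda>n. T / real n"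
  define R where "R n w = (\<Sum>k = 1..n. ?h n * (l \<bullet> Z (real k * ?h n) w))" for n w
  define wn where "wn n = ((\<lambda>m. V (?h n) (m + ?h n *\<^sub>R l)) ^^ n) 0" for n
  have ER: "(\<integral>\<^sup>+w. ennreal (exp (- R n w)) \<partial>M) = ennreal (exp (- (x \<bullet> wn n)))" for n
  proof -
    have "0 \<le> ?h n" using T by simp
    from cb_laplace_riemann_sum[OF M P mk V PV init x this l order_refl, of n]
    show ?thesis by (simp add: R_def wn_def)
  qed
  have Rsum: "R n w = (\<Sum>j\<in>UNIV. l $ j * (\<Sum>k = 1..n. ?h n * Z (real k * ?h n) w $ j))" for n w
    unfolding R_def inner_vec_def sum_distrib_left
    by (subst sum.swap) (simp add: mult_ac)
  have Rm: "R n \<in> borel_measurable M" for n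
    unfolding Rsum[abs_def] using T
    by (intro borel_measurable_sum borel_measurable_times borel_measurable_const cb_process_component(1)[OF cb])
      auto
  have "(\<integral>\<^sup>+w. ennreal (exp (- (\<Sum>j\<in>UNIV. l $ j * (LBINT u:{0<..T}. Z u w $ j)))) \<partial>M)
      = (\<integral>\<^sup>+w. liminf (\<lambda>n. ennreal (exp (- R n w))) \<partial>M)"
  proof (rule nn_integral_cong)
    fix w assume w: "w \<in> space M"
    have "(\<lambda>n. R n w) \<longlonglongrightarrow> (\<Sum>j\<in>UNIV. l $ j * (LBINT u:{0<..T}. Z u w $ j))"
      unfolding Rsum
      by (intro tendsto_sum tendsto_mult tendsto_const cadlag_riemann_sums(2) T cb_process_component(3)[OF cb w])
    then have "(\<lambda>n. ennreal (exp (- R n w))) \<longlonglongrightarrow>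
        ennreal (exp (- (\<Sum>j\<in>UNIV. l $ j * (LBINT u:{0<..T}. Z u w $ j))))"
      by (intro tendsto_ennrealI tendsto_exp tendsto_minus)
    from lim_imp_Liminf[OF _ this]
    show "ennreal (exp (- (\<Sum>j\<in>UNIV. l $ j * (LBINT u:{0<..T}. Z u w $ j))))
        = liminf (\<lambda>n. ennreal (exp (- R n w)))" by simp
  qed
  also have "\<dots> \<le> liminf (\<lambda>n. \<integral>\<^sup>+w. ennreal (exp (- R n w)) \<partial>M)"
    using Rm by (intro nn_integral_liminf) simp
  also have "\<dots> \<le> liminf (\<lambda>n. ennreal (exp (- (x \<bullet> y T) + (\<Sum>i\<in>UNIV. x $ i) * sqrt (excess (y T) (wn n)))))"
  proof (rule Liminf_mono, rule always_eventually, rule allI)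
    fix n
    have "x \<bullet> y T - x \<bullet> wn n = (\<Sum>i\<in>UNIV. x $ i * (y T $ i - wn n $ i))"
      by (simp add: inner_vec_def sum_subtractf[symmetric] right_diff_distrib)
    also have "\<dots> \<le> (\<Sum>i\<in>UNIV. x $ i * sqrt (excess (y T) (wn n)))"
      using x by (intro sum_mono mult_left_mono component_le_sqrt_excess) (simp add: less_eq_vec_def)
    finally have "- (x \<bullet> wn n) \<le> - (x \<bullet> y T) + (\<Sum>i\<in>UNIV. x $ i) * sqrt (excess (y T) (wn n))"
      by (simp add: sum_distrib_right)
    then show "(\<integral>\<^sup>+w. ennreal (exp (- R n w)) \<partial>M) \<le>
        ennreal (exp (- (x \<bullet> y T) + (\<Sum>i\<in>UNIV. x $ i) * sqrt (excess (y T) (wn n))))"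
      unfolding ER by (intro ennreal_leI) (subst exp_le_cancel_iff)
  qed
  also have "\<dots> = ennreal (exp (- (x \<bullet> y T) + (\<Sum>i\<in>UNIV. x $ i) * sqrt 0))"
    by (intro lim_imp_Liminf tendsto_ennrealI tendsto_exp tendsto_add tendsto_const tendsto_mult
        tendsto_real_sqrt splitting_lower_bound[OF adm l y V T, folded wn_def]) auto
  finally show ?thesis by simp
qed

text \<open>
  On the event \<open>A\<close> that all total integrals are finite, \<open>exp (- \<integral>\<^sub>0\<^sup>N l \<bullet> Z\<^sub>u du)\<close> is bounded below by a strictly positive
  \<open>g\<close> that does not depend on \<open>N\<close>. The expectation of \<open>g\<close> over \<open>A\<close> is at most \<open>exp (- y\<^sub>i(N))\<close> for every \<open>N\<close>, hence 0.
\<close>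

lemma cb_total_integral_infinite:
  fixes Z :: "real \<Rightarrow> 'w \<Rightarrow> real ^ 'd::finite"
  assumes adm: "admissible c \<beta> B \<nu> \<mu>" and cb: "cb_process c B \<mu> (axis i 1) M Z"
    and l: "0 \<le> l" and y: "branching_ode c B \<mu> l 0 y" and inf: "ext_limit y $ i = \<infinity>"
  shows "measure M {w \<in> space M. \<exists>j. (\<integral>\<^sup>+u\<in>{0..}. ennreal (Z u w $ j) \<partial>lborel) = \<infinity>} = 1"
proof -
  interpret prob_space M using cb by (simp add: cb_process_def)
  define J where "J T j w = (LBINT u:{0<..T}. Z u w $ j)" for T j w
  define tot where "tot j w = (\<integral>\<^sup>+u\<in>{0..}. ennreal (Z u w $ j) \<partial>lborel)" for j w
  have tot: "tot j w = (SUP N::nat. ennreal (J (real N) j w))" if "w \<in> space M" for j w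
    unfolding tot_def J_def
    by (rule cadlag_nn_integral_eq_SUP[OF cb_process_component(3)[OF cb that]])
      (rule cb_process_component(2)[OF cb _ that])
  have Jm[measurable]: "J (real N) j \<in> borel_measurable M" for N j
    unfolding J_def by (rule borel_measurable_cb_integral[OF cb]) simp
  have totm[measurable]: "tot j \<in> borel_measurable M" for j
  proof (subst measurable_cong[OF tot])
    show "(\<lambda>w. SUP N::nat. ennreal (J (real N) j w)) \<in> borel_measurable M" by measurable
  qed
  define A where "A = {w \<in> space M. \<forall>j. tot j w < \<infinity>}"
  have A[measurable]: "A \<in> sets M" unfolding A_def by measurable
  define g where "g w = exp (- (\<Sum>j\<in>UNIV. l $ j * enn2real (tot j w)))" for w
  have gm[measurable]: "g \<in> borel_measurable M" unfolding g_def by measurable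
  have bound: "(\<integral>\<^sup>+w. indicator A w * ennreal (g w) \<partial>M) \<le> ennreal (exp (- (y (real N) $ i)))" for N :: nat
  proof -
    have "(\<integral>\<^sup>+w. indicator A w * ennreal (g w) \<partial>M)
        \<le> (\<integral>\<^sup>+w. ennreal (exp (- (\<Sum>j\<in>UNIV. l $ j * J (real N) j w))) \<partial>M)"
    proof (rule nn_integral_mono)
      fix w assume w: "w \<in> space M"
      show "indicator A w * ennreal (g w) \<le> ennreal (exp (- (\<Sum>j\<in>UNIV. l $ j * J (real N) j w)))"
      proof (cases "w \<in> A")
        case True
        have "J (real N) j w \<le> enn2real (tot j w)" for j
        proof -
          have fin: "tot j w < \<infinity>" using True by (simp add: A_def)
          have "ennreal (J (real N) j w) \<le> tot j w" unfolding tot[OF w] by (rule SUP_upper) simp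
          also have "\<dots> = ennreal (enn2real (tot j w))" using fin by simp
          finally show ?thesis by (simp add: ennreal_le_iff enn2real_nonneg)
        qed
        then have "(\<Sum>j\<in>UNIV. l $ j * J (real N) j w) \<le> (\<Sum>j\<in>UNIV. l $ j * enn2real (tot j w))"
          using l by (intro sum_mono mult_left_mono) (auto simp: less_eq_vec_def)
        then show ?thesis using True by (simp add: g_def ennreal_leI)
      qed simp
    qed
    also have "\<dots> \<le> ennreal (exp (- (axis i 1 \<bullet> y (real N))))"
      unfolding J_def
      by (rule cb_integral_laplace_le[OF adm cb _ l y]) (auto simp: less_eq_vec_def axis_def)
    finally show ?thesis by (simp add: inner_axis' )
  qed
  have "(\<integral>\<^sup>+w. indicator A w * ennreal (g w) \<partial>M) \<le> ennreal (exp (- real n))" for n :: nat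
  proof -
    have "((\<lambda>t. ennreal (y t $ i)) \<longlongrightarrow> \<infinity>) at_top"
      using ext_limit_increasing(1)[of y i] branching_ode_increasing[OF adm y] inf by simp
    then have "\<forall>\<^sub>F t in at_top. ennreal (real n) < ennreal (y t $ i)"
      by (rule order_tendstoD(1)) simp
    then obtain t0 where t0: "\<And>t. t0 \<le> t \<Longrightarrow> ennreal (real n) < ennreal (y t $ i)"
      unfolding eventually_at_top_linorder by blast
    obtain N :: nat where N: "t0 \<le> real N" using real_arch_simple by blast
    have "real n < y (real N) $ i" using t0[OF N] by (simp add: ennreal_less_iff)
    then have "ennreal (exp (- (y (real N) $ i))) \<le> ennreal (exp (- real n))" by (intro ennreal_leI) simp
    with bound[of N] show ?thesis by (rule order_trans)
  qed
  moreover have "(\<lambda>n. ennreal (exp (- real n))) \<longlonglongrightarrow> ennreal 0"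
  proof (rule tendsto_ennrealI)
    show "(\<lambda>n. exp (- real n)) \<longlonglongrightarrow> 0"
      by (rule filterlim_compose[OF exp_at_bot])
        (rule filterlim_compose[OF filterlim_uminus_at_bot_at_top filterlim_real_sequentially])
  qed
  ultimately have "(\<integral>\<^sup>+w. indicator A w * ennreal (g w) \<partial>M) \<le> ennreal 0"
    by (intro tendsto_lowerbound[OF _ always_eventually]) auto
  then have "AE w in M. indicator A w * ennreal (g w) = 0"
    by (subst nn_integral_0_iff_AE[symmetric]) auto
  then have "AE w in M. \<exists>j. tot j w = \<infinity>"
    using AE_space
  proof eventually_elim
    case (elim w)
    have "0 < g w" by (simp add: g_def)
    then have "w \<notin> A" using elim(1) by (auto simp: indicator_def)
    then show ?case using elim(2) by (simp add: A_def not_less top_unique)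
  qed
  moreover have "{w \<in> space M. \<exists>j. tot j w = \<infinity>} \<in> sets M" by measurable
  ultimately show ?thesis using prob_Collect_eq_1 by (auto simp: tot_def[symmetric])
qed

lemma total_integral_infinite_iff:
  "total_integral Z w \<notin> ennreal_vec ` {0..} \<longleftrightarrow> (\<exists>j. (\<integral>\<^sup>+u\<in>{0..}. ennreal (Z u w $ j) \<partial>lborel) = \<infinity>)"
proof -
  have "a \<in> ennreal_vec ` {0..} \<longleftrightarrow> (\<forall>j. a $ j \<noteq> \<infinity>)" for a :: "ennreal ^ 'a"
  proof
    assume fin: "\<forall>j. a $ j \<noteq> \<infinity>"
    let ?x = "\<chi> j. enn2real (a $ j)"
    have "a = ennreal_vec ?x" using fin by (simp add: vec_eq_iff ennreal_vec_def less_top)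
    moreover have "?x \<in> {0..}" by (simp add: less_eq_vec_def)
    ultimately show "a \<in> ennreal_vec ` {0..}" by (rule image_eqI)
  qed (auto simp: ennreal_vec_def)
  then show ?thesis by (simp add: total_integral_def)
qed

theorem proposition3p5:
  fixes c \<beta> :: "real ^ 'd::finite"
    and B :: "real ^ 'd ^ 'd"
    and \<nu> :: "(real ^ 'd) measure"
    and \<mu> :: "'d \<Rightarrow> (real ^ 'd) measure"
    and vt :: "real \<Rightarrow> real ^ 'd \<Rightarrow> real ^ 'd"
  assumes "admissible c \<beta> B \<nu> \<mu>"
    and "\<forall>l\<ge>0. branching_ode c B \<mu> l 0 (\<lambda>t. vt t l)"
  shows
    "(\<forall>l\<ge>0. mono_on {0..} (\<lambda>t. vt t l) \<and>
        ((\<lambda>t. ennreal_vec (vt t l)) \<longlongrightarrow> ext_limit (\<lambda>t. vt t l)) at_top)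
     \<and>
     (\<forall>l\<in>pos_orthant. \<forall>i (M :: 'w measure) Z.
        cb_process c B \<mu> (axis i 1) M Z \<longrightarrow> ext_limit (\<lambda>t. vt t l) $ i = \<infinity> \<longrightarrow>
          \<P>(w in M. \<exists>j. (\<integral>\<^sup>+ u\<in>{0..}. ennreal (Z u w $ j) \<partial>lborel) = \<infinity>)
            = \<P>(w in M. total_integral Z w \<notin> ennreal_vec ` {0..}) \<and>
          \<P>(w in M. total_integral Z w \<notin> ennreal_vec ` {0..}) = 1)
     \<and>
     (irreducible_matrix (mean_matrix B \<mu>) \<longrightarrow>
        (\<forall>l\<ge>0. l \<noteq> 0 \<longrightarrow> (\<forall>j. 0 < ext_limit (\<lambda>t. vt t l) $ j)))
     \<and>
     (branching_domain c B \<mu> \<noteq> {} \<longrightarrow>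
        (\<forall>\<phi>. branching_inverse c B \<mu> \<phi> \<longrightarrow>
          (\<forall>l\<in>pos_orthant.
             (\<forall>j. 0 < ext_limit (\<lambda>t. vt t l) $ j \<and> ext_limit (\<lambda>t. vt t l) $ j < \<infinity>) \<longrightarrow>
             ext_limit (\<lambda>t. vt t l) = ennreal_vec (\<phi> l))))"
proof -
  note adm = assms(1)
  have ode: "branching_ode c B \<mu> l 0 (\<lambda>t. vt t l)" if "0 \<le> l" for l
    using assms(2) that by blast
  have pos: "0 \<le> l" if "l \<in> pos_orthant" for l :: "real ^ 'd"
    using that by (simp add: pos_orthant_def less_eq_vec_def less_imp_le)
  have incr: "vt s l \<le> vt t l" if "0 \<le> l" "0 \<le> s" "s \<le> t" for l s t
    by (rule branching_ode_increasing[OF adm ode[OF that(1)] that(2,3)])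
  show ?thesis
  proof (intro conjI allI impI ballI)
    fix l :: "real ^ 'd" assume l: "0 \<le> l"
    show "mono_on {0..} (\<lambda>t. vt t l)" using incr[OF l] by (intro mono_onI) simp
    show "((\<lambda>t. ennreal_vec (vt t l)) \<longlongrightarrow> ext_limit (\<lambda>t. vt t l)) at_top"
      by (rule ennreal_vec_tendsto_ext_limit) (rule incr[OF l])
  next
    fix l :: "real ^ 'd" and i and M :: "'w measure" and Z
    assume l: "l \<in> pos_orthant" and cb: "cb_process c B \<mu> (axis i 1) M Z"
      and inf: "ext_limit (\<lambda>t. vt t l) $ i = \<infinity>"
    show "\<P>(w in M. total_integral Z w \<notin> ennreal_vec ` {0..}) = 1"
      unfolding total_integral_infinite_iff
      by (rule cb_total_integral_infinite[OF adm cb pos[OF l] ode[OF pos[OF l]] inf])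
    show "\<P>(w in M. \<exists>j. (\<integral>\<^sup>+ u\<in>{0..}. ennreal (Z u w $ j) \<partial>lborel) = \<infinity>)
        = \<P>(w in M. total_integral Z w \<notin> ennreal_vec ` {0..})"
      unfolding total_integral_infinite_iff ..
  next
    fix l :: "real ^ 'd" and j assume "irreducible_matrix (mean_matrix B \<mu>)" "0 \<le> l" "l \<noteq> 0"
    then show "0 < ext_limit (\<lambda>t. vt t l) $ j" using ext_limit_pos[OF adm ode] by blast
  next
    fix \<phi> and l :: "real ^ 'd" assume \<phi>: "branching_inverse c B \<mu> \<phi>" and l: "l \<in> pos_orthant"
      and "\<forall>j. 0 < ext_limit (\<lambda>t. vt t l) $ j \<and> ext_limit (\<lambda>t. vt t l) $ j < \<infinity>"
    then show "ext_limit (\<lambda>t. vt t l) = ennreal_vec (\<phi> l)"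
      by (intro ext_limit_eq_branching_inverse[OF adm ode[OF pos[OF l]] l \<phi>]) blast
  qed
qed

end
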